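(* For every integer $n\ge 0$, the following identity of polynomials in $x$ holds: $$\sum_{g\ge 0}A(n,g)\,x^{n+1-2g}=\frac{(2n)!}{2^n\,n!\,(n+1)!}\,(1+\mathrm{E})^n\,(x+n)_{n+1}.$$
   Context: $\mathrm{E}$ is the backward shift operator on polynomials, $(\mathrm{E}f)(x)=f(x-1)$; $(1+\mathrm{E})^n$ is the $n$-th power of the operator $1+\mathrm{E}$, where $1$ is the identity. $(a)_m=a(a-1)\cdots(a-m+1)$ is the falling factorial. $A(n,g)$ is the number of rooted one-face maps of genus $g$ with $n$ edges, up to equivalence. A rooted one-face map with $n$ edges is encoded as a triple $(\alpha,\beta,\gamma)$ of permutations of $\{1,\dots,2n\}$ where $\alpha$ is an involution without fixed points (its cycles are the edges), $\gamma=(1,2,\dots,2n)$ is the long cycle (the boundary), and $\gamma=\alpha\beta$ (the cycles of $\beta$ are the vertices; products are composed right to left). The root has label $1$. Two triples $(\alpha,\beta,\gamma)$, $(\alpha',\beta',\gamma')$ are equivalent if there is a permutation $\pi$ with $\alpha'=\pi\alpha\pi^{-1}$, $\gamma'=\pi\gamma\pi^{-1}$, $\pi(1)=1$ (since $\gamma=\gamma'=(1,2,\dots,2n)$, this forces $\pi$ to be the identity). The genus $g$ is determined by $v-n+1=2-2g$, where $v$ is the number of cycles of $\beta$. Thus $A(n,g)$ is the number of fixed-point-free involutions $\alpha$ of $\{1,\dots,2n\}$ such that $\alpha^{-1}\gamma$ has exactly $n+1-2g$ cycles; in particular $A(n,g)=0$ if $2g>n$. For $n=0$ the only map is the single vertex: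 $A(0,0)=1$ and $A(0,g)=0$ for $g>0$. *)

theory Defs
  imports
    Complex_Main
    "HOL-Combinatorics.Orbits"
    "HOL-Combinatorics.Cycles"
    "HOL-Computational_Algebra.Polynomial"
    "HOL-Library.Groups_Big_Fun"
begin

subsection \<open>Rooted one-face maps\<close>

text \<open>
  Permutations of \<open>{1..2 * n}\<close> are functions on the naturals that fix everything outside
  this set.
\<close>

type_synonym map_triple = "(nat \<Rightarrow> nat) \<times> (nat \<Rightarrow> nat) \<times> (nat \<Rightarrow> nat)"

definition fpf_involution :: "nat \<Rightarrow> (nat \<Rightarrow> nat) \<Rightarrow> bool" where
  "fpf_involution n \<alpha> \<longleftrightarrow>
     \<alpha> permutes {1..2 * n} \<and> \<alpha> \<circ> \<alpha> = id \<and> (\<forall>i\<in>{1..2 * n}. \<alpha> i \<noteq> i)"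

definition long_cycle :: "nat \<Rightarrow> nat \<Rightarrow> nat" where
  "long_cycle n = cycle_of_list [1..<Suc (2 * n)]"

definition rooted_one_face_maps :: "nat \<Rightarrow> map_triple set" where
  "rooted_one_face_maps n =
     {(\<alpha>, \<beta>, \<gamma>). fpf_involution n \<alpha> \<and> \<beta> permutes {1..2 * n} \<and>
        \<gamma> = long_cycle n \<and> \<gamma> = \<alpha> \<circ> \<beta>}"

definition rooted_equiv :: "nat \<Rightarrow> (map_triple \<times> map_triple) set" where
  "rooted_equiv n =
     {((\<alpha>, \<beta>, \<gamma>), (\<alpha>', \<beta>', \<gamma>')).
        (\<alpha>, \<beta>, \<gamma>) \<in> rooted_one_face_maps n \<and> (\<alpha>', \<beta>', \<gamma>') \<in> rooted_one_face_maps n \<and>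
        (\<exists>\<pi>. \<pi> permutes {1..2 * n} \<and> \<pi> 1 = 1 \<and>
             \<alpha>' = \<pi> \<circ> \<alpha> \<circ> inv \<pi> \<and> \<gamma>' = \<pi> \<circ> \<gamma> \<circ> inv \<pi>)}"

text \<open>
  The vertices are the cycles of \<open>\<beta>\<close>, fixed points included. The map without edges is
  the exception: it has one vertex, although the permutation of the empty set has no cycle.
\<close>

definition num_vertices :: "nat \<Rightarrow> (nat \<Rightarrow> nat) \<Rightarrow> nat" where
  "num_vertices n \<beta> = (if n = 0 then 1 else card (orbit \<beta> ` {1..2 * n}))"

definition maps_of_genus :: "nat \<Rightarrow> nat \<Rightarrow> map_triple set" where
  "maps_of_genus n g =
     {(\<alpha>, \<beta>, \<gamma>) \<in> rooted_one_face_maps n.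
        int (num_vertices n \<beta>) - int n + 1 = 2 - 2 * int g}"

text \<open>
  The genus is invariant under \<open>rooted_equiv n\<close>, so we count the equivalence classes of
  maps of genus \<open>g\<close>.
\<close>

definition num_maps :: "nat \<Rightarrow> nat \<Rightarrow> nat" where
  "num_maps n g = card (maps_of_genus n g // rooted_equiv n)"


subsection \<open>Polynomials\<close>

definition backward_shift :: "real poly \<Rightarrow> real poly" where
  "backward_shift f = pcompose f [:- 1, 1:]"

lemma poly_backward_shift: "poly (backward_shift f) x = poly f (x - 1)"
  by (simp add: backward_shift_def poly_pcompose)

definition falling_factorial :: "'a::comm_ring_1 \<Rightarrow> nat \<Rightarrow> 'a" where
  "falling_factorial a m = (\<Prod>i<m. a - of_nat i)"


subsection \<open>Consistency of the definitions\<close>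

lemma long_cycle_permutes: "long_cycle n permutes {1..2 * n}"
proof -
  have "set [1..<Suc (2 * n)] = {1..2 * n}" by auto
  then show ?thesis unfolding long_cycle_def by (metis cycle_permutes)
qed

lemma long_cycle_map: "map (long_cycle n) [1..<Suc (2 * n)] = rotate1 [1..<Suc (2 * n)]"
  using cyclic_rotation[of "[1..<Suc (2 * n)]" 1] by (simp add: long_cycle_def)

lemma long_cycle_step:
  assumes "1 \<le> i" "i < 2 * n"
  shows "long_cycle n i = Suc i"
proof -
  have "map (long_cycle n) [1..<Suc (2 * n)] ! (i - 1) = rotate1 [1..<Suc (2 * n)] ! (i - 1)"
    by (simp only: long_cycle_map)
  then show ?thesis using assms
    by (simp add: nth_rotate1 del: upt_Suc)
qed

lemma long_cycle_last:
  assumes "n > 0"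
  shows "long_cycle n (2 * n) = 1"
proof -
  have "map (long_cycle n) [1..<Suc (2 * n)] ! (2 * n - 1) = rotate1 [1..<Suc (2 * n)] ! (2 * n - 1)"
    by (simp only: long_cycle_map)
  then show ?thesis using assms
    by (simp add: nth_rotate1 del: upt_Suc)
qed

lemma rooted_automorphism_trivial:
  assumes p: "\<pi> permutes {1..2 * n}" and one: "\<pi> 1 = 1"
    and conj: "long_cycle n = \<pi> \<circ> long_cycle n \<circ> inv \<pi>"
  shows "\<pi> = id"
proof -
  have comm: "long_cycle n (\<pi> i) = \<pi> (long_cycle n i)" for i
    using fun_cong[OF conj, of "\<pi> i"] permutes_inverses(2)[OF p] by simp
  have fixed: "Suc i \<le> 2 * n \<Longrightarrow> \<pi> (Suc i) = Suc i" for i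
  proof (induction i)
    case 0
    then show ?case using one by simp
  next
    case (Suc i)
    then show ?case using comm[of "Suc i"] long_cycle_step[of "Suc i" n] by simp
  qed
  show ?thesis
  proof
    fix i
    show "\<pi> i = id i"
    proof (cases "i \<in> {1..2 * n}")
      case True
      then show ?thesis using fixed[of "i - 1"] by simp
    next
      case False
      then show ?thesis using p by (simp add: permutes_not_in)
    qed
  qed
qed

lemma rooted_equiv_eq: "rooted_equiv n = Id_on (rooted_one_face_maps n)"
proof (intro set_eqI iffI)
  fix z assume z: "z \<in> rooted_equiv n"
  then obtain \<alpha> \<beta> \<gamma> \<alpha>' \<beta>' \<gamma>' \<pi> where
    zz: "z = ((\<alpha>, \<beta>, \<gamma>), (\<alpha>', \<beta>', \<gamma>'))" and
    M: "(\<alpha>, \<beta>, \<gamma>) \<in> rooted_one_face_maps n" and M': "(\<alpha>', \<beta>', \<gamma>') \<in> rooted_one_face_maps n" and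
    p: "\<pi> permutes {1..2 * n}" "\<pi> 1 = 1" and
    a: "\<alpha>' = \<pi> \<circ> \<alpha> \<circ> inv \<pi>" and c: "\<gamma>' = \<pi> \<circ> \<gamma> \<circ> inv \<pi>"
    unfolding rooted_equiv_def by blast
  have g: "\<gamma> = long_cycle n" "\<gamma>' = long_cycle n" "\<gamma> = \<alpha> \<circ> \<beta>" "\<gamma>' = \<alpha>' \<circ> \<beta>'"
    and inv: "\<alpha> \<circ> \<alpha> = id"
    using M M' unfolding rooted_one_face_maps_def fpf_involution_def by blast+
  have "\<pi> = id" using rooted_automorphism_trivial[OF p] c unfolding g(1,2) by blast
  then have "\<alpha>' = \<alpha>" using a by simp
  then have "\<alpha> \<circ> (\<alpha> \<circ> \<beta>') = \<alpha> \<circ> (\<alpha> \<circ> \<beta>)" using g by metis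
  then have "\<beta>' = \<beta>" using inv by (simp add: comp_assoc[symmetric])
  with \<open>\<alpha>' = \<alpha>\<close> show "z \<in> Id_on (rooted_one_face_maps n)"
    using M unfolding zz g(1,2) by (simp add: Id_on_def)
next
  fix z assume "z \<in> Id_on (rooted_one_face_maps n)"
  then obtain \<alpha> \<beta> \<gamma> where
    zz: "z = ((\<alpha>, \<beta>, \<gamma>), (\<alpha>, \<beta>, \<gamma>))" and M: "(\<alpha>, \<beta>, \<gamma>) \<in> rooted_one_face_maps n"
    by (cases z) auto
  have "\<exists>\<pi>. \<pi> permutes {1..2 * n} \<and> \<pi> 1 = 1 \<and>
    \<alpha> = \<pi> \<circ> \<alpha> \<circ> inv \<pi> \<and> \<gamma> = \<pi> \<circ> \<gamma> \<circ> inv \<pi>"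
    by (rule exI[of _ id]) (simp add: permutes_id)
  then show "z \<in> rooted_equiv n"
    unfolding rooted_equiv_def zz using M by simp
qed

lemma equiv_rooted_equiv: "equiv (rooted_one_face_maps n) (rooted_equiv n)"
  by (auto simp: rooted_equiv_eq equiv_def refl_on_def sym_def trans_def)

lemma num_maps_eq_card: "num_maps n g = card (maps_of_genus n g)"
proof -
  have "maps_of_genus n g // rooted_equiv n = (\<lambda>M. {M}) ` maps_of_genus n g"
    by (auto simp: quotient_def rooted_equiv_eq maps_of_genus_def)
  then show ?thesis by (simp add: num_maps_def card_image)
qed

theorem num_maps_eq_card_involutions:
  assumes "n > 0"
  shows "num_maps n g =
    card {\<alpha>. fpf_involution n \<alpha> \<and> card (orbit (inv \<alpha> \<circ> long_cycle n) ` {1..2 * n}) + 2 * g = n + 1}"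
    (is "_ = card ?S")
proof -
  have "bij_betw (\<lambda>\<alpha>. (\<alpha>, inv \<alpha> \<circ> long_cycle n, long_cycle n)) ?S (maps_of_genus n g)"
  proof (rule bij_betw_byWitness[where f' = fst])
    show "(\<lambda>\<alpha>. (\<alpha>, inv \<alpha> \<circ> long_cycle n, long_cycle n)) ` ?S \<subseteq> maps_of_genus n g"
    proof (rule image_subsetI)
      fix \<alpha> assume \<alpha>: "\<alpha> \<in> ?S"
      then have p: "\<alpha> permutes {1..2 * n}" by (simp add: fpf_involution_def)
      have "\<alpha> \<circ> (inv \<alpha> \<circ> long_cycle n) = long_cycle n"
        using permutes_inv_o(1)[OF p] by (simp add: comp_assoc[symmetric])
      moreover have "inv \<alpha> \<circ> long_cycle n permutes {1..2 * n}"
        by (intro permutes_compose long_cycle_permutes permutes_inv p)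
      ultimately show "(\<alpha>, inv \<alpha> \<circ> long_cycle n, long_cycle n) \<in> maps_of_genus n g"
        using \<alpha> assms
        by (simp add: maps_of_genus_def rooted_one_face_maps_def num_vertices_def)
    qed
    have b: "inv \<alpha> \<circ> long_cycle n = \<beta> \<and> \<gamma> = long_cycle n \<and> fpf_involution n \<alpha>"
      if "(\<alpha>, \<beta>, \<gamma>) \<in> maps_of_genus n g" for \<alpha> \<beta> \<gamma>
    proof -
      have p: "\<alpha> permutes {1..2 * n}" and g: "long_cycle n = \<alpha> \<circ> \<beta>" "\<gamma> = long_cycle n"
        and f: "fpf_involution n \<alpha>"
        using that unfolding maps_of_genus_def rooted_one_face_maps_def fpf_involution_def
        by blast+
      have "inv \<alpha> \<circ> long_cycle n = \<beta>"
        unfolding g(1) using permutes_inv_o(2)[OF p] by (simp add: comp_assoc[symmetric])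
      then show ?thesis using g(2) f by blast
    qed
    show "\<forall>M\<in>maps_of_genus n g. (\<lambda>\<alpha>. (\<alpha>, inv \<alpha> \<circ> long_cycle n, long_cycle n)) (fst M) = M"
    proof
      fix M assume M: "M \<in> maps_of_genus n g"
      obtain \<alpha> \<beta> \<gamma> where MM: "M = (\<alpha>, \<beta>, \<gamma>)" by (cases M)
      show "(\<lambda>\<alpha>. (\<alpha>, inv \<alpha> \<circ> long_cycle n, long_cycle n)) (fst M) = M"
        using b[of \<alpha> \<beta> \<gamma>] M unfolding MM by simp
    qed
    show "fst ` maps_of_genus n g \<subseteq> ?S"
    proof (rule image_subsetI)
      fix M assume M: "M \<in> maps_of_genus n g"
      obtain \<alpha> \<beta> \<gamma> where MM: "M = (\<alpha>, \<beta>, \<gamma>)" by (cases M)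
      have "int (num_vertices n \<beta>) - int n + 1 = 2 - 2 * int g"
        using M MM by (simp add: maps_of_genus_def)
      then have "card (orbit \<beta> ` {1..2 * n}) + 2 * g = n + 1"
        using assms by (simp add: num_vertices_def)
      then show "fst M \<in> ?S" using b[of \<alpha> \<beta> \<gamma>] M MM by simp
    qed
  qed simp
  then have "card ?S = card (maps_of_genus n g)" by (rule bij_betw_same_card)
  then show ?thesis by (simp only: num_maps_eq_card)
qed

lemma num_maps_0: "num_maps 0 g = (if g = 0 then 1 else 0)"
proof -
  have "rooted_one_face_maps 0 = {(id, id, id)}"
    by (auto simp: rooted_one_face_maps_def fpf_involution_def long_cycle_def)
  then have "maps_of_genus 0 g = (if g = 0 then {(id, id, id)} else {})"
    by (auto simp: maps_of_genus_def num_vertices_def)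
  then show ?thesis by (simp add: num_maps_eq_card)
qed

lemma num_maps_eq_0:
  assumes "2 * g > n"
  shows "num_maps n g = 0"
proof -
  have "int (num_vertices n \<beta>) - int n + 1 \<noteq> 2 - 2 * int g" for \<beta>
  proof -
    have "num_vertices n \<beta> > 0"
      by (auto simp: num_vertices_def card_gt_0_iff)
    then show ?thesis using assms by linarith
  qed
  then have "maps_of_genus n g = {}"
    unfolding maps_of_genus_def by blast
  then show ?thesis by (simp add: num_maps_eq_card)
qed

text \<open>
  Hence the sum over all genera of the generating polynomial has finite support, and the
  exponent \<open>n + 1 - 2 * g\<close> is never truncated in a nonzero term.
\<close>

lemma finite_num_maps_support:
  "finite {g. monom (of_nat (num_maps n g) :: real) (n + 1 - 2 * g) \<noteq> 0}"
proof (rule finite_subset)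
  show "{g. monom (of_nat (num_maps n g) :: real) (n + 1 - 2 * g) \<noteq> 0} \<subseteq> {..n}"
  proof
    fix g assume "g \<in> {g. monom (of_nat (num_maps n g) :: real) (n + 1 - 2 * g) \<noteq> 0}"
    then have "num_maps n g \<noteq> 0" by auto
    then have "\<not> 2 * g > n" using num_maps_eq_0[of n g] by auto
    then show "g \<in> {..n}" by simp
  qed
qed simp

end

theory Submission
  imports Defs
begin

text \<open>
  The formula is the case of fixed-point-free involutions of a statement about an arbitrary
  permutation \<open>\<rho>\<close> of \<open>{1..N}\<close>. Let \<open>Q\<^sub>\<rho>(z)\<close> be the product of
  \<open>(1 + z)^l - z^l\<close> over the cycle lengths \<open>l\<close> of \<open>\<rho>\<close>, and let \<open>L\<^sub>x\<close> be the linear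
  functional with \<open>L\<^sub>x (z^t) = x gchoose (t + 1)\<close>. Then the sum of \<open>x^cyc(\<rho> \<circ> \<gamma>)\<close> over
  all \<open>N\<close>-cycles \<open>\<gamma>\<close> is \<open>(N - 1)! L\<^sub>x (Q\<^sub>\<rho>)\<close>.

  This is proved by induction on \<open>N\<close>: every \<open>(N + 1)\<close>-cycle is uniquely \<open>\<gamma> \<circ> (j N+1)\<close>
  with an \<open>N\<close>-cycle \<open>\<gamma>\<close>. If \<open>\<rho>\<close> arises from \<open>\<sigma>\<close> by inserting \<open>N + 1\<close> before \<open>m\<close>,
  the sum for \<open>\<rho>\<close> is \<open>x\<close> times the sum for \<open>\<sigma>\<close> plus the sums for \<open>(j m) \<circ> \<sigma>\<close>,
  \<open>j \<noteq> m\<close>. Multiplication by \<open>x\<close> corresponds to \<open>Q \<mapsto> ((z + z^2) Q)'\<close> under \<open>L\<^sub>x\<close>, and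
  the resulting identity between polynomials in \<open>z\<close> is checked cycle by cycle.

  All \<open>N\<close>-cycles are conjugate and fixed-point-free involutions form a conjugacy class, so one may
  sum over the involutions for one fixed \<open>\<gamma>\<close> instead. For these \<open>Q = (1 + 2z)^n\<close>. Since
  \<open>L\<^sub>x\<^sub>-\<^sub>1 ((1 + z) R) = L\<^sub>x (z R)\<close>, applying \<open>1 + E\<close> to \<open>L\<^sub>x ((1 + z) R)\<close> gives
  \<open>L\<^sub>x ((1 + 2z) R)\<close>, and \<open>L\<^sub>x ((1 + z)^n) = (x + n) gchoose (n + 1)\<close>.
\<close>

subsection \<open>Products over the cycles of a permutation\<close>

text \<open>The product runs over the set of orbits, so each cycle counts once. \<open>X\<close> may
  be any union of cycles, which allows cycles to be split off one by one. Two weights occur below: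
  the constant \<open>x\<close>, giving \<open>x\<close> to the number of cycles, and
  \<open>shift_poly\<close>, giving the polynomial Q.\<close>

definition cycle_weight ::
    "(nat \<Rightarrow> 'b::comm_monoid_mult) \<Rightarrow> 'a set \<Rightarrow> ('a \<Rightarrow> 'a) \<Rightarrow> 'b" where
  "cycle_weight w X \<sigma> = (\<Prod>C\<in>orbit \<sigma> ` X. w (card C))"

lemma orbit_eq_iff:
  assumes "permutation \<sigma>"
  shows "orbit \<sigma> x = orbit \<sigma> y \<longleftrightarrow> x \<in> orbit \<sigma> y"
  by (metis assms cyclic_on_orbit' orbit_cyclic_eq3 permutation_self_in_orbit)

lemma cycle_weight_Un:
  assumes "permutation \<sigma>" "finite X" "finite Y" "X \<inter> Y = {}" "\<And>x. x \<in> X \<Longrightarrow> orbit \<sigma> x \<subseteq> X"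
  shows "cycle_weight w (X \<union> Y) \<sigma> = cycle_weight w X \<sigma> * cycle_weight w Y \<sigma>"
proof -
  have "orbit \<sigma> ` X \<inter> orbit \<sigma> ` Y = {}"
  proof (rule ccontr)
    assume "orbit \<sigma> ` X \<inter> orbit \<sigma> ` Y \<noteq> {}"
    then obtain x y where "x \<in> X" "y \<in> Y" "orbit \<sigma> y = orbit \<sigma> x" by auto
    then have "y \<in> X"
      using permutation_self_in_orbit[OF assms(1), of y] assms(5)[of x] by auto
    then show False using \<open>y \<in> Y\<close> assms(4) by blast
  qed
  then show ?thesis
    using assms by (simp add: cycle_weight_def image_Un prod.union_disjoint)
qed

lemma cycle_weight_orbit:
  assumes "permutation \<sigma>"
  shows "cycle_weight w (orbit \<sigma> a) \<sigma> = w (card (orbit \<sigma> a))"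
proof -
  have "orbit \<sigma> ` orbit \<sigma> a = (\<lambda>_. orbit \<sigma> a) ` orbit \<sigma> a"
    using assms by (intro image_cong) (simp_all add: orbit_eq_iff)
  also have "\<dots> = {orbit \<sigma> a}"
    using orbit_nonempty[of \<sigma> a] by (simp add: image_constant_conv)
  finally show ?thesis by (simp add: cycle_weight_def)
qed

lemma cycle_weight_cong:
  assumes "\<And>x. x \<in> X \<Longrightarrow> orbit \<sigma> x = orbit \<tau> x"
  shows "cycle_weight w X \<sigma> = cycle_weight w X \<tau>"
  using assms by (simp add: cycle_weight_def cong: image_cong)

lemma cycle_weight_split_off:
  assumes "\<sigma> permutes X" "finite X" "a \<in> X"
  shows "cycle_weight w X \<sigma> = w (card (orbit \<sigma> a)) * cycle_weight w (X - orbit \<sigma> a) \<sigma>"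
proof -
  have p: "permutation \<sigma>" using assms permutation_permutes by blast
  have s: "orbit \<sigma> a \<subseteq> X" using assms permutes_orbit_subset by metis
  have "cycle_weight w (orbit \<sigma> a \<union> (X - orbit \<sigma> a)) \<sigma> =
      cycle_weight w (orbit \<sigma> a) \<sigma> * cycle_weight w (X - orbit \<sigma> a) \<sigma>"
    using p assms s by (intro cycle_weight_Un) (auto intro: finite_subset orbit_trans)
  then show ?thesis using s p by (simp add: cycle_weight_orbit Un_absorb1)
qed

lemma cycle_weight_conj:
  assumes "\<sigma> permutes X" "finite X" "\<pi> permutes X"
  shows "cycle_weight w X (\<pi> \<circ> \<sigma> \<circ> inv \<pi>) = cycle_weight w X \<sigma>"
proof -
  have p: "permutation \<sigma>" using assms permutation_permutes by blast
  have o: "orbit (\<pi> \<circ> \<sigma> \<circ> inv \<pi>) (\<pi> x) = \<pi> ` orbit \<sigma> x" for x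
    using orbit_inverse[OF permutation_self_in_orbit[OF p], where g' = "\<pi> \<circ> \<sigma> \<circ> inv \<pi>" and f = \<pi>]
      permutes_inverses(2)[OF assms(3)] by simp
  have inj: "inj \<pi>" using assms permutes_inj by blast
  have "orbit (\<pi> \<circ> \<sigma> \<circ> inv \<pi>) ` X = orbit (\<pi> \<circ> \<sigma> \<circ> inv \<pi>) ` \<pi> ` X"
    using permutes_image[OF assms(3)] by simp
  also have "\<dots> = (`) \<pi> ` orbit \<sigma> ` X"
    by (simp only: image_image o)
  finally show ?thesis using inj
    by (simp add: cycle_weight_def prod.reindex inj_on_subset[OF inj_on_image] card_image
        inj_on_def inj_image_eq_iff inj_def)
qed

section \<open>Listing the points of a cycle, and the effect of a transposition on cycles\<close>

text \<open>The powers of \<sigma> number the cycle of \<open>a\<close> by 0, ...,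
  \<open>l - 1\<close>; splitting and merging of cycles are read off in this numbering.\<close>

lemma cycle_parametrization:
  fixes a :: 'a
  assumes "permutation \<sigma>"
  defines "l \<equiv> card (orbit \<sigma> a)"
  shows "l > 0" "(\<sigma> ^^ l) a = a" "inj_on (\<lambda>i. (\<sigma> ^^ i) a) {..<l}"
    "orbit \<sigma> a = (\<lambda>i. (\<sigma> ^^ i) a) ` {..<l}"
proof -
  let ?k = "funpow_dist1 \<sigma> a a"
  have self: "a \<in> orbit \<sigma> a" using assms permutation_self_in_orbit by metis
  have o: "orbit \<sigma> a = (\<lambda>i. (\<sigma> ^^ i) a) ` {0..<?k}" by (rule orbit_conv_funpow_dist1[OF self])
  have i: "inj_on (\<lambda>i. (\<sigma> ^^ i) a) {0..<?k}" by (rule inj_on_funpow_dist1[OF self])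
  have l: "l = ?k" using o card_image[OF i] unfolding l_def by simp
  show "l > 0" using l by simp
  show "(\<sigma> ^^ l) a = a" using funpow_dist1_prop[OF self] l by simp
  show "inj_on (\<lambda>i. (\<sigma> ^^ i) a) {..<l}" using i unfolding l by (simp add: atLeast0LessThan)
  show "orbit \<sigma> a = (\<lambda>i. (\<sigma> ^^ i) a) ` {..<l}" using o unfolding l by (simp add: atLeast0LessThan)
qed

text \<open>It is enough to follow \<tau> from \<open>x\<close> along a list that closes up; the
  list may repeat values.\<close>

lemma orbit_eq_image:
  assumes "f 0 = x" "\<And>i. Suc i < k \<Longrightarrow> \<tau> (f i) = f (Suc i)" "k > 0" "\<tau> (f (k - 1)) = x"
  shows "orbit \<tau> x = f ` {..<k}"
proof -
  have f: "i < k \<Longrightarrow> (\<tau> ^^ i) x = f i" for i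
    by (induction i) (use assms in auto)
  have "(\<tau> ^^ k) x = \<tau> ((\<tau> ^^ (k - 1)) x)" using assms(3) by (cases k) auto
  then have "(\<tau> ^^ k) x = x" using f[of "k - 1"] assms by simp
  then have "orbit \<tau> x = {(\<tau> ^^ m) x |m. m < k}" using assms(3) by (rule orbit_altdef_bounded)
  then show ?thesis using f by force
qed

text \<open>The transposition redirects only the two arrows that enter \<open>a\<close> and
  \<open>(\<sigma> ^^ d) a\<close>: each of the two arcs between these points now returns to its own
  start.\<close>

lemma orbit_transpose_split:
  assumes p: "permutation \<sigma>" and "0 < d" "d < card (orbit \<sigma> a)"
  defines "\<tau> \<equiv> transpose ((\<sigma> ^^ d) a) a \<circ> \<sigma>"
  shows "orbit \<tau> a = (\<lambda>i. (\<sigma> ^^ i) a) ` {..<d}"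
    "orbit \<tau> ((\<sigma> ^^ d) a) = (\<lambda>i. (\<sigma> ^^ i) a) ` {d..<card (orbit \<sigma> a)}"
proof -
  define l where "l = card (orbit \<sigma> a)"
  note c = cycle_parametrization[OF p, of a, folded l_def]
  have dl: "d < l" using assms l_def by simp
  have ne: "i < l \<Longrightarrow> j < l \<Longrightarrow> (\<sigma> ^^ i) a = (\<sigma> ^^ j) a \<longleftrightarrow> i = j" for i j
    using inj_on_eq_iff[OF c(3)] by simp
  have ne0: "i < l \<Longrightarrow> (\<sigma> ^^ i) a = a \<longleftrightarrow> i = 0" for i
    using ne[of i 0] dl by auto
  have step: "\<tau> ((\<sigma> ^^ i) a) = (\<sigma> ^^ Suc i) a" if "Suc i < l" "Suc i \<noteq> d" for i
    using ne[of "Suc i" d] ne0[of "Suc i"] that dl unfolding \<tau>_def by (simp add: transpose_def)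
  have stepd: "\<tau> ((\<sigma> ^^ i) a) = a" if "Suc i = d" for i
    using that unfolding \<tau>_def by auto
  have stepl: "\<tau> ((\<sigma> ^^ i) a) = (\<sigma> ^^ d) a" if "Suc i = l" for i
    using that c(2) unfolding \<tau>_def by auto
  show "orbit \<tau> a = (\<lambda>i. (\<sigma> ^^ i) a) ` {..<d}"
    using step stepd assms dl by (intro orbit_eq_image) auto
  have "orbit \<tau> ((\<sigma> ^^ d) a) = (\<lambda>i. (\<sigma> ^^ (d + i)) a) ` {..<l - d}"
  proof (intro orbit_eq_image)
    show "\<tau> ((\<sigma> ^^ (d + i)) a) = (\<sigma> ^^ (d + Suc i)) a" if "Suc i < l - d" for i
      using step[of "d + i"] that by simp
    show "\<tau> ((\<sigma> ^^ (d + (l - d - 1))) a) = (\<sigma> ^^ d) a"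
      using stepl[of "d + (l - d - 1)"] dl by simp
  qed (use dl in auto)
  also have "\<dots> = (\<lambda>i. (\<sigma> ^^ i) a) ` (\<lambda>i. d + i) ` {..<l - d}"
    by (simp only: image_image)
  also have "(\<lambda>i. d + i) ` {..<l - d} = {d..<l}"
    using dl image_add_atLeastLessThan[of d 0 "l - d"] by (simp add: atLeast0LessThan)
  finally show "orbit \<tau> ((\<sigma> ^^ d) a) = (\<lambda>i. (\<sigma> ^^ i) a) ` {d..<card (orbit \<sigma> a)}"
    by (simp add: l_def)
qed

text \<open>Again only the arrows into \<open>a\<close> and \<open>b\<close> change, and they are
  exchanged: the end of the cycle of \<open>a\<close> leads to \<open>b\<close>, and the end of the
  cycle of \<open>b\<close> leads to \<open>a\<close>.\<close>

lemma orbit_transpose_merge: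
  assumes p: "permutation \<sigma>" and ab: "b \<notin> orbit \<sigma> a"
  shows "orbit (transpose b a \<circ> \<sigma>) a = orbit \<sigma> a \<union> orbit \<sigma> b"
proof -
  define k l \<tau> where "k = card (orbit \<sigma> a)" and "l = card (orbit \<sigma> b)"
    and "\<tau> = transpose b a \<circ> \<sigma>"
  note c = cycle_parametrization[OF p, of a, folded k_def]
  note d = cycle_parametrization[OF p, of b, folded l_def]
  have a: "a \<in> orbit \<sigma> a" and b: "b \<in> orbit \<sigma> b"
    using p permutation_self_in_orbit by metis+
  have nab: "a \<notin> orbit \<sigma> b" using ab a b orbit_eq_iff[OF p] by metis
  have st1: "\<tau> ((\<sigma> ^^ i) a) = (\<sigma> ^^ Suc i) a" if "Suc i < k" for i
  proof -
    have "(\<sigma> ^^ Suc i) a \<noteq> a"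
      using inj_on_eq_iff[OF c(3), of "Suc i" 0] that by simp
    moreover have "(\<sigma> ^^ Suc i) a \<noteq> b"
      using funpow_in_orbit[OF a, of "Suc i"] ab by metis
    ultimately show ?thesis by (simp add: \<tau>_def transpose_def)
  qed
  have st2: "\<tau> ((\<sigma> ^^ i) b) = (\<sigma> ^^ Suc i) b" if "Suc i < l" for i
  proof -
    have "(\<sigma> ^^ Suc i) b \<noteq> b"
      using inj_on_eq_iff[OF d(3), of "Suc i" 0] that by simp
    moreover have "(\<sigma> ^^ Suc i) b \<noteq> a"
      using funpow_in_orbit[OF b, of "Suc i"] nab by metis
    ultimately show ?thesis by (simp add: \<tau>_def transpose_def)
  qed
  have e1: "\<tau> ((\<sigma> ^^ i) a) = b" if "Suc i = k" for i
    using c(2) that by (auto simp: \<tau>_def)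
  have e2: "\<tau> ((\<sigma> ^^ i) b) = a" if "Suc i = l" for i
    using d(2) that by (auto simp: \<tau>_def)
  define f where "f i = (if i < k then (\<sigma> ^^ i) a else (\<sigma> ^^ (i - k)) b)" for i
  have "orbit \<tau> a = f ` {..<k + l}"
  proof (rule orbit_eq_image)
    show "f 0 = a" using c by (simp add: f_def)
    show "\<tau> (f i) = f (Suc i)" if "Suc i < k + l" for i
    proof -
      consider "Suc i < k" | "Suc i = k" | "i \<ge> k" by linarith
      then show ?thesis
      proof cases
        case 3
        then show ?thesis using that st2[of "i - k"] by (simp add: f_def Suc_diff_le)
      qed (use st1[of i] e1[of i] in \<open>auto simp: f_def\<close>)
    qed
    show "\<tau> (f (k + l - 1)) = a"
    proof -
      have "\<not> k + l - 1 < k" "k + l - 1 - k = l - 1" using d(1) by auto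
      then show ?thesis using d(1) e2[of "l - 1"] by (simp only: f_def if_False)
    qed
  qed (use c in auto)
  also have "{..<k + l} = {..<k} \<union> (\<lambda>i. i + k) ` {..<l}"
    using image_add_atLeastLessThan'[of k 0 l] by (auto simp: atLeast0LessThan add.commute)
  also have "f ` \<dots> = (\<lambda>i. (\<sigma> ^^ i) a) ` {..<k} \<union> (\<lambda>i. (\<sigma> ^^ i) b) ` {..<l}"
  proof -
    have "f ` {..<k} = (\<lambda>i. (\<sigma> ^^ i) a) ` {..<k}"
      by (intro image_cong) (auto simp: f_def)
    moreover have "f ` (\<lambda>i. i + k) ` {..<l} = (\<lambda>i. (\<sigma> ^^ i) b) ` {..<l}"
      unfolding image_image by (intro image_cong) (auto simp: f_def)
    ultimately show ?thesis by (simp only: image_Un)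
  qed
  finally show ?thesis unfolding \<tau>_def c(4)[symmetric] d(4)[symmetric] .
qed

lemma orbit_transpose_other:
  assumes p: "permutation \<sigma>" and "x \<notin> orbit \<sigma> a" "x \<notin> orbit \<sigma> b"
  shows "orbit (transpose b a \<circ> \<sigma>) x = orbit \<sigma> x"
proof (rule orbit_cong)
  show "x \<in> orbit \<sigma> x" using p permutation_self_in_orbit by metis
next
  fix s assume "s \<in> orbit \<sigma> x"
  then have "\<sigma> s \<in> orbit \<sigma> x" by (rule orbit.step)
  then have "\<sigma> s \<noteq> a" "\<sigma> s \<noteq> b"
    using assms by (metis orbit_eq_iff permutation_self_in_orbit)+
  then show "(transpose b a \<circ> \<sigma>) s = \<sigma> s" by (simp add: transpose_def)
qed

section \<open>Cycle weights under merging and splitting\<close>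

lemma cycle_weight_transpose_merge:
  assumes s: "\<sigma> permutes X" "finite X" "a \<in> X" "b \<in> X" and ab: "b \<notin> orbit \<sigma> a"
  shows "cycle_weight w X (transpose b a \<circ> \<sigma>) =
    w (card (orbit \<sigma> a) + card (orbit \<sigma> b)) * cycle_weight w (X - orbit \<sigma> a - orbit \<sigma> b) \<sigma>"
proof -
  let ?\<tau> = "transpose b a \<circ> \<sigma>"
  have p: "permutation \<sigma>" using s permutation_permutes by blast
  have t: "?\<tau> permutes X" using s by (intro permutes_compose permutes_swap_id) auto
  have fin: "finite (orbit \<sigma> a)" "finite (orbit \<sigma> b)"
    using s by (meson finite_subset permutes_orbit_subset)+
  have disj: "orbit \<sigma> a \<inter> orbit \<sigma> b = {}"
    using ab orbit_eq_iff[OF p] by blast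
  have "cycle_weight w X ?\<tau> = w (card (orbit ?\<tau> a)) * cycle_weight w (X - orbit ?\<tau> a) ?\<tau>"
    by (rule cycle_weight_split_off[OF t s(2,3)])
  also have "X - orbit ?\<tau> a = X - orbit \<sigma> a - orbit \<sigma> b"
    unfolding orbit_transpose_merge[OF p ab] by blast
  also have "cycle_weight w (X - orbit \<sigma> a - orbit \<sigma> b) ?\<tau> =
      cycle_weight w (X - orbit \<sigma> a - orbit \<sigma> b) \<sigma>"
    using orbit_transpose_other[OF p] by (intro cycle_weight_cong) auto
  also have "card (orbit ?\<tau> a) = card (orbit \<sigma> a) + card (orbit \<sigma> b)"
    unfolding orbit_transpose_merge[OF p ab] using fin disj by (rule card_Un_disjoint)
  finally show ?thesis .
qed

lemma cycle_weight_split_off_two: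
  assumes s: "\<sigma> permutes X" "finite X" "a \<in> X" "b \<in> X" and ab: "b \<notin> orbit \<sigma> a"
  shows "cycle_weight w (X - orbit \<sigma> a) \<sigma> =
    w (card (orbit \<sigma> b)) * cycle_weight w (X - orbit \<sigma> a - orbit \<sigma> b) \<sigma>"
proof -
  have p: "permutation \<sigma>" using s permutation_permutes by blast
  have disj: "orbit \<sigma> a \<inter> orbit \<sigma> b = {}"
    using ab orbit_eq_iff[OF p] by blast
  have sub: "orbit \<sigma> b \<subseteq> X" using s by (meson permutes_orbit_subset)
  then have "X - orbit \<sigma> a = orbit \<sigma> b \<union> (X - orbit \<sigma> a - orbit \<sigma> b)"
    using disj by blast
  moreover have "cycle_weight w (orbit \<sigma> b \<union> (X - orbit \<sigma> a - orbit \<sigma> b)) \<sigma> =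
      cycle_weight w (orbit \<sigma> b) \<sigma> * cycle_weight w (X - orbit \<sigma> a - orbit \<sigma> b) \<sigma>"
    using p s sub by (intro cycle_weight_Un) (auto intro: finite_subset orbit_trans)
  ultimately show ?thesis using p by (simp add: cycle_weight_orbit)
qed

lemma cycle_weight_transpose_split:
  assumes s: "\<sigma> permutes X" "finite X" "a \<in> X" and d: "0 < d" "d < card (orbit \<sigma> a)"
  shows "cycle_weight w X (transpose ((\<sigma> ^^ d) a) a \<circ> \<sigma>) =
    w d * w (card (orbit \<sigma> a) - d) * cycle_weight w (X - orbit \<sigma> a) \<sigma>"
proof -
  let ?b = "(\<sigma> ^^ d) a" and ?l = "card (orbit \<sigma> a)" and ?f = "\<lambda>i. (\<sigma> ^^ i) a"
  let ?\<tau> = "transpose ?b a \<circ> \<sigma>"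
  have p: "permutation \<sigma>" using s permutation_permutes by blast
  have a: "a \<in> orbit \<sigma> a" using p permutation_self_in_orbit by metis
  have b: "?b \<in> orbit \<sigma> a" by (rule funpow_in_orbit[OF a])
  have bX: "?b \<in> X" using b s by (meson permutes_orbit_subset subsetD)
  have t: "?\<tau> permutes X" using s bX by (intro permutes_compose permutes_swap_id) auto
  note c = cycle_parametrization[OF p, of a]
  note sp = orbit_transpose_split[OF p d]
  have U: "orbit \<sigma> a = orbit ?\<tau> a \<union> orbit ?\<tau> ?b"
  proof -
    have "{..<?l} = {..<d} \<union> {d..<?l}" using d by auto
    then show ?thesis unfolding sp by (subst c(4)) (simp only: image_Un)
  qed
  have disj: "?b \<notin> orbit ?\<tau> a"
  proof
    assume "?b \<in> orbit ?\<tau> a"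
    then obtain i where i: "i < d" "?f d = ?f i" unfolding sp by auto
    then have "d = i" using inj_on_eq_iff[OF c(3), of d i] d by simp
    then show False using i by simp
  qed
  have c1: "card (orbit ?\<tau> a) = d" unfolding sp
    using card_image[OF inj_on_subset[OF c(3)], of "{..<d}"] d by auto
  have c2: "card (orbit ?\<tau> ?b) = ?l - d" unfolding sp
    using card_image[OF inj_on_subset[OF c(3)], of "{d..<?l}"] by (simp add: subset_iff)
  have "cycle_weight w X ?\<tau> = w (card (orbit ?\<tau> a)) * cycle_weight w (X - orbit ?\<tau> a) ?\<tau>"
    by (rule cycle_weight_split_off[OF t s(2,3)])
  also have "\<dots> = w d * w (?l - d) * cycle_weight w (X - orbit ?\<tau> a - orbit ?\<tau> ?b) ?\<tau>"
    by (subst cycle_weight_split_off_two[OF t s(2,3) bX disj]) (simp only: c1 c2 mult.assoc)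
  also have "X - orbit ?\<tau> a - orbit ?\<tau> ?b = X - orbit \<sigma> a" using U by blast
  also have "cycle_weight w (X - orbit \<sigma> a) ?\<tau> = cycle_weight w (X - orbit \<sigma> a) \<sigma>"
    using orbit_transpose_other[OF p] b orbit_eq_iff[OF p, of ?b a]
    by (intro cycle_weight_cong) auto
  finally show ?thesis .
qed

text \<open>The points of the cycle other than \<open>a\<close> are \<open>(\<sigma> ^^ i) a\<close>
  with i between 1 and the length minus 1, and the i-th one cuts the cycle into arcs of length i and
  of the remaining length; hence the convolution.\<close>

lemma sum_cycle_weight_transpose_same_orbit:
  fixes w :: "nat \<Rightarrow> 'b::comm_semiring_1"
  assumes s: "\<sigma> permutes X" "finite X" "a \<in> X"
  shows "(\<Sum>j\<in>orbit \<sigma> a - {a}. cycle_weight w X (transpose j a \<circ> \<sigma>)) =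
    (\<Sum>i=1..<card (orbit \<sigma> a). w i * w (card (orbit \<sigma> a) - i)) * cycle_weight w (X - orbit \<sigma> a) \<sigma>"
proof -
  let ?l = "card (orbit \<sigma> a)" and ?f = "\<lambda>i. (\<sigma> ^^ i) a"
  have p: "permutation \<sigma>" using s permutation_permutes by blast
  note c = cycle_parametrization[OF p, of a]
  have "{1..<?l} = {..<?l} - {0}" by auto
  then have "?f ` {1..<?l} = ?f ` {..<?l} - ?f ` {0}"
    using c by (simp add: inj_on_image_set_diff[OF c(3)])
  then have "orbit \<sigma> a - {a} = ?f ` {1..<?l}" using c(4) by simp
  moreover have "inj_on ?f {1..<?l}" by (rule inj_on_subset[OF c(3)]) auto
  ultimately show ?thesis
    using cycle_weight_transpose_split[OF s, of _ w]
    by (simp add: sum.reindex sum_distrib_right)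
qed

section \<open>Adding a new point to a permutation\<close>

lemma cycle_weight_insert_fixed:
  assumes "\<sigma> permutes X" "finite X" "a \<notin> X"
  shows "cycle_weight w (insert a X) \<sigma> = w 1 * cycle_weight w X \<sigma>"
proof -
  have "\<sigma> a = a" using assms by (auto simp: permutes_def)
  then have o: "orbit \<sigma> a = {a}" by (simp add: orbit_eq_singleton_iff)
  have "cycle_weight w (insert a X) \<sigma> =
      w (card (orbit \<sigma> a)) * cycle_weight w (insert a X - orbit \<sigma> a) \<sigma>"
    using assms by (intro cycle_weight_split_off) (auto intro: permutes_subset)
  then show ?thesis using assms(3) unfolding o by simp
qed

text \<open>The new point \<open>a\<close> is fixed by \<sigma>, thus a cycle of length 1, and
  inserting it means merging this cycle with that of \<open>m\<close>.\<close>

lemma cycle_weight_insert_into_cycle: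
  assumes s: "\<sigma> permutes X" "finite X" "a \<notin> X" "m \<in> X"
  shows "cycle_weight w (insert a X) (transpose a m \<circ> \<sigma>) =
    w (Suc (card (orbit \<sigma> m))) * cycle_weight w (X - orbit \<sigma> m) \<sigma>"
proof -
  have "\<sigma> a = a" using assms by (auto simp: permutes_def)
  then have o: "orbit \<sigma> a = {a}" by (simp add: orbit_eq_singleton_iff)
  have sub: "orbit \<sigma> m \<subseteq> X" using s by (meson permutes_orbit_subset)
  have "cycle_weight w (insert a X) (transpose a m \<circ> \<sigma>) =
    w (card (orbit \<sigma> m) + card (orbit \<sigma> a)) * cycle_weight w (insert a X - orbit \<sigma> m - orbit \<sigma> a) \<sigma>"
    using s sub by (intro cycle_weight_transpose_merge) (auto intro: permutes_subset)
  moreover have "insert a X - orbit \<sigma> m - {a} = X - orbit \<sigma> m" using s by auto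
  ultimately show ?thesis unfolding o by simp
qed

subsection \<open>The cycle polynomial of a permutation\<close>

text \<open>The factor of Q contributed by a cycle of length \<open>k\<close>; the polynomial
  variable is z, not the \<open>x\<close> that counts cycles.\<close>

definition shift_poly :: "nat \<Rightarrow> real poly" where
  "shift_poly k = [:1, 1:] ^ k - [:0, 1:] ^ k"

abbreviation class_poly :: "'a set \<Rightarrow> ('a \<Rightarrow> 'a) \<Rightarrow> real poly" where
  "class_poly \<equiv> cycle_weight shift_poly"

text \<open>A cycle \<open>D\<close> is the orbit of exactly \<open>card D\<close> points. This
  translates between sums over points and sums over cycles, in both directions.\<close>

lemma sum_over_orbits:
  fixes h :: "'a set \<Rightarrow> 'b::comm_semiring_1"
  assumes p: "permutation \<sigma>" and fin: "finite Y" and Y: "\<And>x. x \<in> Y \<Longrightarrow> orbit \<sigma> x \<subseteq> Y"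
  shows "(\<Sum>j\<in>Y. h (orbit \<sigma> j)) = (\<Sum>D\<in>orbit \<sigma> ` Y. of_nat (card D) * h D)"
proof -
  have "(\<Sum>j\<in>Y. h (orbit \<sigma> j)) =
      (\<Sum>D\<in>orbit \<sigma> ` Y. \<Sum>j\<in>{j \<in> Y. orbit \<sigma> j = D}. h (orbit \<sigma> j))"
    using fin by (rule sum.image_gen)
  also have "\<dots> = (\<Sum>D\<in>orbit \<sigma> ` Y. of_nat (card D) * h D)"
  proof (rule sum.cong[OF refl])
    fix D assume "D \<in> orbit \<sigma> ` Y"
    then obtain x where x: "x \<in> Y" "D = orbit \<sigma> x" by (rule imageE) simp
    then have "D \<subseteq> Y" using Y by simp
    then have "{j \<in> Y. orbit \<sigma> j = D} = D" using orbit_eq_iff[OF p] x(2) by auto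
    moreover have "(\<Sum>j\<in>{j \<in> Y. orbit \<sigma> j = D}. h (orbit \<sigma> j)) =
        (\<Sum>j\<in>{j \<in> Y. orbit \<sigma> j = D}. h D)"
      by (rule sum.cong) simp_all
    ultimately show "(\<Sum>j\<in>{j \<in> Y. orbit \<sigma> j = D}. h (orbit \<sigma> j)) = of_nat (card D) * h D"
      by (simp only: sum_constant)
  qed
  finally show ?thesis .
qed

section \<open>Identities for single cycles and the recurrence for the cycle polynomial\<close>

text \<open>The factor z + z^2 restores the exponents lowered by differentiation, so only
  \<open>k\<close>-th powers occur and \<open>k = 0\<close> is included.\<close>

lemma pderiv_shift_poly:
  "[:0, 1, 1:] * pderiv (shift_poly k) =
    of_nat k * ([:0, 1:] * [:1, 1:] ^ k - [:1, 1:] * [:0, 1:] ^ k)"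
proof (cases k)
  case 0
  then show ?thesis by (simp add: shift_poly_def)
next
  case (Suc m)
  have e: "[:0, 1, 1:] = ([:0, 1:] * [:1, 1:] :: real poly)" by simp
  have d: "pderiv ([:1, 1:] :: real poly) = 1" "pderiv ([:0, 1:] :: real poly) = 1"
    by (simp_all add: pderiv_pCons)
  show ?thesis
    unfolding shift_poly_def Suc e pderiv_diff pderiv_power_Suc d of_nat_mult_conv_smult[symmetric]
    unfolding power_Suc
    by (simp only: algebra_simps mult_1_right)
qed

text \<open>With u = 1 + z everything follows from u - z = 1. This is the balance for a cycle of
  length \<open>k\<close> that avoids m: either the derivative hits its factor, or one of its
  \<open>k\<close> points is merged with the cycle of m, of length \<open>l\<close>.\<close>

lemma shift_poly_merge:
  "shift_poly l * ([:0, 1, 1:] * pderiv (shift_poly k)) + of_nat k * shift_poly (l + k) =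
    of_nat k * (shift_poly (Suc l) * shift_poly k)"
proof -
  define u z :: "real poly" where "u = [:1, 1:]" and "z = [:0, 1:]"
  have u: "u = 1 + z" by (simp add: u_def z_def one_pCons)
  show ?thesis
    unfolding pderiv_shift_poly
    unfolding shift_poly_def u_def[symmetric] z_def[symmetric] power_add power_Suc
    unfolding u by algebra
qed

text \<open>The balance for the cycle of m itself, of length \<open>l\<close>: the sum accounts for
  its splittings, and the derivative also acts on the factor z + z^2.\<close>

lemma sum_shift_poly:
  "(\<Sum>i=1..<l. shift_poly i * shift_poly (l - i)) + pderiv ([:0, 1, 1:] * shift_poly l) =
    of_nat l * shift_poly (Suc l)"
proof (cases l)
  case 0
  then show ?thesis by (simp add: shift_poly_def)
next
  case (Suc m)
  define u z :: "real poly" where "u = [:1, 1:]" and "z = [:0, 1:]"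
  have u: "u = 1 + z" by (simp add: u_def z_def one_pCons)
  have s: "shift_poly k = u ^ k - z ^ k" for k by (simp add: shift_poly_def u_def z_def)
  have split: "(\<Sum>i=1..<l. u ^ i * z ^ (l - i)) = u ^ l * z - u * z ^ l"
  proof -
    \<comment> \<open>Multiplication by u - z = 1 makes the sum telescope.\<close>
    have "(\<Sum>i=1..<l. u ^ i * z ^ (l - i)) = (u - z) * (\<Sum>i=1..<l. u ^ i * z ^ (l - i))"
      by (simp add: u)
    also have "\<dots> = (\<Sum>i=1..<l. u ^ Suc i * z ^ (l - i) - u ^ i * z ^ (l - i + 1))"
      by (simp add: sum_distrib_left algebra_simps)
    also have "\<dots> = (\<Sum>i=1..<l. u ^ Suc i * z ^ (Suc l - Suc i) - u ^ i * z ^ (Suc l - i))"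
      by (intro sum.cong) (auto simp: Suc_diff_le)
    also have "\<dots> = u ^ l * z ^ (Suc l - l) - u ^ 1 * z ^ (Suc l - 1)"
      by (rule sum_Suc_diff') (use Suc in simp)
    finally show ?thesis by simp
  qed
  have split': "(\<Sum>i=1..<l. z ^ i * u ^ (l - i)) = u ^ l * z - u * z ^ l"
    unfolding split[symmetric]
    by (rule sum.reindex_bij_witness[of _ "\<lambda>i. l - i" "\<lambda>i. l - i"]) auto
  have "(\<Sum>i=1..<l. shift_poly i * shift_poly (l - i)) =
     (\<Sum>i=1..<l. (u ^ l + z ^ l) - u ^ i * z ^ (l - i) - z ^ i * u ^ (l - i))"
    by (intro sum.cong) (auto simp: s algebra_simps simp flip: power_add)
  also have "\<dots> = of_nat m * (u ^ l + z ^ l) - 2 * (u ^ l * z - u * z ^ l)"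
    unfolding sum_subtractf split split' using Suc by simp
  finally have 1: "(\<Sum>i=1..<l. shift_poly i * shift_poly (l - i)) =
     of_nat m * (u ^ l + z ^ l) - 2 * (u ^ l * z - u * z ^ l)" .
  have 2: "pderiv ([:0, 1, 1:] * shift_poly l) =
    of_nat l * (z * u ^ l - u * z ^ l) + (1 + 2 * z) * (u ^ l - z ^ l)"
  proof -
    have "pderiv [:0, 1, 1:] = (1 + 2 * z :: real poly)"
      by (simp add: pderiv_pCons z_def one_pCons numeral_poly)
    then show ?thesis
      unfolding pderiv_mult pderiv_shift_poly by (simp add: s u_def z_def mult.commute)
  qed
  have 3: "(of_nat l :: real poly) = 1 + of_nat m" using Suc by simp
  show ?thesis unfolding 1 2 unfolding 3 s power_Suc unfolding u by algebra
qed

text \<open>The product rule assigns the derivative to single cycles. The cycle of \<open>m\<close>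
  then yields its length by \<open>sum_shift_poly\<close>, every other cycle yields its length by
  \<open>shift_poly_merge\<close>, and the lengths add up to \<open>card X\<close>. The polynomial
  on the right is that of \<sigma> with a new point inserted before \<open>m\<close>.\<close>

theorem class_poly_recurrence:
  assumes s: "\<sigma> permutes X" "finite X" "m \<in> X"
  shows "pderiv ([:0, 1, 1:] * class_poly X \<sigma>) +
      (\<Sum>j\<in>X - {m}. class_poly X (transpose j m \<circ> \<sigma>)) =
    of_nat (card X) * (shift_poly (Suc (card (orbit \<sigma> m))) * class_poly (X - orbit \<sigma> m) \<sigma>)"
proof -
  define C Y l where "C = orbit \<sigma> m" and "Y = X - C" and "l = card C"
  let ?P = "[:0, 1, 1:] :: real poly" and ?q = shift_poly
  let ?R = "class_poly Y \<sigma>" and ?O = "orbit \<sigma> ` Y"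
  have p: "permutation \<sigma>" using s permutation_permutes by blast
  have CX: "C \<subseteq> X" unfolding C_def using s by (meson permutes_orbit_subset)
  have mC: "m \<in> C" unfolding C_def using p permutation_self_in_orbit by metis
  have fin: "finite Y" "finite C" using s CX by (auto simp: Y_def intro: finite_subset)
  have Y: "orbit \<sigma> j \<subseteq> Y" if "j \<in> Y" for j
  proof -
    have "orbit \<sigma> j \<subseteq> X" using s that by (metis Y_def Diff_iff permutes_orbit_subset)
    moreover have "orbit \<sigma> j \<inter> C = {}"
      using that orbit_eq_iff[OF p] unfolding Y_def C_def by blast
    ultimately show ?thesis by (auto simp: Y_def)
  qed
  have cX: "class_poly X \<sigma> = ?q l * ?R"
    using cycle_weight_split_off[OF s, of shift_poly] by (simp add: C_def Y_def l_def)
  have orb: "(\<Sum>j\<in>C - {m}. class_poly X (transpose j m \<circ> \<sigma>)) =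
      (\<Sum>i=1..<l. ?q i * ?q (l - i)) * ?R"
    using sum_cycle_weight_transpose_same_orbit[OF s, of shift_poly]
    by (simp add: C_def Y_def l_def)
  \<comment> \<open>This product over the remaining cycles has the shape of the terms of the product
    rule in \<open>R'\<close>.\<close>
  have rest: "cycle_weight ?q (Y - orbit \<sigma> j) \<sigma> = (\<Prod>D\<in>?O - {orbit \<sigma> j}. ?q (card D))"
    if "j \<in> Y" for j
  proof -
    have "orbit \<sigma> ` (Y - orbit \<sigma> j) = ?O - {orbit \<sigma> j}"
      using orbit_eq_iff[OF p] by auto
    then show ?thesis by (simp add: cycle_weight_def)
  qed
  have "(\<Sum>j\<in>Y. class_poly X (transpose j m \<circ> \<sigma>)) =
      (\<Sum>j\<in>Y. ?q (l + card (orbit \<sigma> j)) * (\<Prod>D\<in>?O - {orbit \<sigma> j}. ?q (card D)))"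
  proof (intro sum.cong refl)
    fix j assume j: "j \<in> Y"
    then have "j \<in> X" "j \<notin> orbit \<sigma> m" by (auto simp: Y_def C_def)
    then show "class_poly X (transpose j m \<circ> \<sigma>) =
        ?q (l + card (orbit \<sigma> j)) * (\<Prod>D\<in>?O - {orbit \<sigma> j}. ?q (card D))"
      using cycle_weight_transpose_merge[OF s, of j ?q] rest[OF j]
      by (simp add: C_def l_def Y_def)
  qed
  also have "\<dots> = (\<Sum>D\<in>?O. of_nat (card D) * (?q (l + card D) * (\<Prod>E\<in>?O - {D}. ?q (card E))))"
    by (rule sum_over_orbits[OF p fin(1) Y])
  finally have other: "(\<Sum>j\<in>Y. class_poly X (transpose j m \<circ> \<sigma>)) =
    (\<Sum>D\<in>?O. of_nat (card D) * (?q (l + card D) * (\<Prod>E\<in>?O - {D}. ?q (card E))))" .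
  have R': "pderiv ?R = (\<Sum>D\<in>?O. (\<Prod>E\<in>?O - {D}. ?q (card E)) * pderiv (?q (card D)))"
    unfolding cycle_weight_def pderiv_prod ..
  have "?q l * (?P * pderiv ?R) + (\<Sum>j\<in>Y. class_poly X (transpose j m \<circ> \<sigma>)) =
      (\<Sum>D\<in>?O. (?q l * (?P * pderiv (?q (card D))) + of_nat (card D) * ?q (l + card D)) *
        (\<Prod>E\<in>?O - {D}. ?q (card E)))"
    unfolding other R' sum_distrib_left sum.distrib[symmetric]
    by (intro sum.cong refl) (simp only: algebra_simps)
  also have "\<dots> = (\<Sum>D\<in>?O. of_nat (card D) * (?q (Suc l) * ?R))"
  proof (intro sum.cong refl)
    fix D assume "D \<in> ?O"
    then have "?R = ?q (card D) * (\<Prod>E\<in>?O - {D}. ?q (card E))"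
      using fin unfolding cycle_weight_def by (intro prod.remove) auto
    then show "(?q l * (?P * pderiv (?q (card D))) + of_nat (card D) * ?q (l + card D)) *
        (\<Prod>E\<in>?O - {D}. ?q (card E)) = of_nat (card D) * (?q (Suc l) * ?R)"
      unfolding shift_poly_merge by (simp only: mult.assoc)
  qed
  \<comment> \<open>Read backwards, the sum weighted by cycle lengths has one equal term for each
    point of \<open>Y\<close>.\<close>
  also have "\<dots> = (\<Sum>j\<in>Y. ?q (Suc l) * ?R)"
    by (rule sum_over_orbits[OF p fin(1) Y, symmetric])
  finally have A: "?q l * (?P * pderiv ?R) + (\<Sum>j\<in>Y. class_poly X (transpose j m \<circ> \<sigma>)) =
      of_nat (card Y) * (?q (Suc l) * ?R)" by simp
  have "X - {m} = (C - {m}) \<union> Y" using CX mC by (auto simp: Y_def)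
  then have "(\<Sum>j\<in>X - {m}. class_poly X (transpose j m \<circ> \<sigma>)) =
      (\<Sum>i=1..<l. ?q i * ?q (l - i)) * ?R + (\<Sum>j\<in>Y. class_poly X (transpose j m \<circ> \<sigma>))"
    using fin orb by (simp add: sum.union_disjoint Y_def Diff_Int_distrib2 Int_Diff)
  moreover have "pderiv (?P * class_poly X \<sigma>) = pderiv (?P * ?q l) * ?R + ?q l * (?P * pderiv ?R)"
    unfolding cX mult.assoc[symmetric] pderiv_mult[of "?P * ?q l"] by (simp only: algebra_simps)
  moreover have "card X = l + card Y"
    using s CX fin by (simp add: Y_def l_def card_Diff_subset card_mono)
  ultimately have "pderiv (?P * class_poly X \<sigma>) +
      (\<Sum>j\<in>X - {m}. class_poly X (transpose j m \<circ> \<sigma>)) =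
    ((\<Sum>i=1..<l. ?q i * ?q (l - i)) + pderiv (?P * ?q l)) * ?R + of_nat (card Y) * (?q (Suc l) * ?R)"
    using A by (simp only: algebra_simps)
  also have "\<dots> = of_nat (card X) * (?q (Suc l) * ?R)"
    unfolding sum_shift_poly \<open>card X = l + card Y\<close> of_nat_add by (simp only: algebra_simps)
  finally show ?thesis by (simp only: C_def Y_def l_def)
qed

subsection \<open>A functional on polynomials\<close>

definition binomial_functional :: "real \<Rightarrow> real poly \<Rightarrow> real" where
  "binomial_functional x p = (\<Sum>i\<le>degree p. coeff p i * (x gchoose Suc i))"

lemma binomial_functional_bound:
  assumes "degree p \<le> n"
  shows "binomial_functional x p = (\<Sum>i\<le>n. coeff p i * (x gchoose Suc i))"
  unfolding binomial_functional_def
  using assms by (intro sum.mono_neutral_left) (auto simp: coeff_eq_0)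

lemma binomial_functional_add:
  "binomial_functional x (p + q) = binomial_functional x p + binomial_functional x q"
proof -
  let ?n = "max (degree p) (degree q)"
  have "degree (p + q) \<le> ?n" by (rule degree_add_le_max)
  then show ?thesis
    by (simp add: binomial_functional_bound[of _ ?n] sum.distrib[symmetric] algebra_simps)
qed

lemma binomial_functional_smult:
  "binomial_functional x (smult c p) = c * binomial_functional x p"
  by (simp add: binomial_functional_bound[of _ "degree p"] sum_distrib_left mult.assoc)

lemma binomial_functional_of_nat_mult:
  "binomial_functional x (of_nat k * p) = of_nat k * binomial_functional x p"
  by (simp add: of_nat_mult_conv_smult binomial_functional_smult)

lemma binomial_functional_monom [simp]:
  "binomial_functional x (monom c k) = c * (x gchoose Suc k)"
proof -
  have "(\<Sum>i\<le>k. coeff (monom c k) i * (x gchoose Suc i)) =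
      (\<Sum>i\<le>k. if i = k then c * (x gchoose Suc k) else 0)"
    by (intro sum.cong) auto
  then show ?thesis
    by (simp add: binomial_functional_bound[OF degree_monom_le])
qed

lemma binomial_functional_sum:
  "binomial_functional x (sum f A) = (\<Sum>a\<in>A. binomial_functional x (f a))"
  by (rule additive.sum) (simp add: additive_def binomial_functional_add)

text \<open>Every polynomial is a sum of monomials. This reduces identities for the functional to
  identities between binomial coefficients.\<close>

lemma poly_additive_eqI:
  fixes f g :: "'a::comm_monoid_add poly \<Rightarrow> 'b::ab_group_add"
  assumes f: "\<And>p q. f (p + q) = f p + f q" and g: "\<And>p q. g (p + q) = g p + g q"
    and m: "\<And>c k. f (monom c k) = g (monom c k)"
  shows "f p = g p"
proof -
  have z: "f 0 = 0" "g 0 = 0" using f[of 0 0] g[of 0 0] by simp_all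
  have "f (\<Sum>i\<in>A. monom (coeff p i) i) = g (\<Sum>i\<in>A. monom (coeff p i) i)" if "finite A" for A
    using that by induction (simp_all add: z f g m)
  from this[of "{..degree p}"] show ?thesis by (simp add: poly_as_sum_of_monoms)
qed

section \<open>Multiplication by x, shift and reflection of x under the functional\<close>

text \<open>On z^k this is x binom(x, k+1) = (k+1) binom(x, k+1) + (k+2) binom(x, k+2).\<close>

lemma mult_binomial_functional:
  "x * binomial_functional x p = binomial_functional x (pderiv ([:0, 1, 1:] * p))"
proof (rule poly_additive_eqI[where p = p])
  fix c :: real and k
  have "[:0, 1, 1:] * monom c k = monom c (Suc k) + monom c (Suc (Suc k))"
    by (simp add: monom_Suc)
  then have "binomial_functional x (pderiv ([:0, 1, 1:] * monom c k)) =
      real (Suc k) * c * (x gchoose Suc k) + real (Suc (Suc k)) * c * (x gchoose Suc (Suc k))"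
    by (simp add: pderiv_add pderiv_monom binomial_functional_add)
  also have "\<dots> = x * (c * (x gchoose Suc k))"
    using gbinomial_mult_1[of x "Suc k"] by (metis (no_types, opaque_lifting) distrib_left
        mult.assoc mult.commute)
  finally show "x * binomial_functional x (monom c k) =
      binomial_functional x (pderiv ([:0, 1, 1:] * monom c k))" by simp
qed (simp_all only: binomial_functional_add pderiv_add distrib_left)

text \<open>On monomials this is Pascal's rule.\<close>

lemma binomial_functional_shift:
  "binomial_functional (x - 1) ([:1, 1:] * p) = binomial_functional x ([:0, 1:] * p)"
proof (rule poly_additive_eqI[where p = p])
  fix c :: real and k
  have "[:1, 1:] * monom c k = monom c k + monom c (Suc k)" "[:0, 1:] * monom c k = monom c (Suc k)"
    by (simp_all add: monom_Suc)
  then show "binomial_functional (x - 1) ([:1, 1:] * monom c k) =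
      binomial_functional x ([:0, 1:] * monom c k)"
    using gbinomial_Suc_Suc[of "x - 1" "Suc k"]
    by (simp add: binomial_functional_add algebra_simps)
qed (simp_all only: binomial_functional_add distrib_left)

text \<open>Pascal's rule again; \<open>t\<close> is general because expanding one factor 1 + z
  raises it by one.\<close>

lemma binomial_functional_monom_mult_power:
  "binomial_functional x (monom 1 t * [:1, 1:] ^ n) = (x + real n) gchoose (n + t + 1)"
proof (induction n arbitrary: t)
  case 0
  then show ?case by simp
next
  case (Suc n)
  have "monom (1 :: real) t * [:1, 1:] ^ Suc n =
      monom 1 t * [:1, 1:] ^ n + monom 1 (Suc t) * [:1, 1:] ^ n"
    by (simp add: monom_Suc algebra_simps)
  then have "binomial_functional x (monom 1 t * [:1, 1:] ^ Suc n) =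
      ((x + real n) gchoose (n + t + 1)) + ((x + real n) gchoose (n + Suc t + 1))"
    by (simp only: Suc binomial_functional_add)
  also have "\<dots> = (x + real n + 1) gchoose Suc (n + t + 1)"
    unfolding gbinomial_Suc_Suc by simp
  finally show ?case by (simp add: ac_simps)
qed

lemma pcompose_power: "pcompose (p ^ k) q = pcompose p q ^ k"
  for p :: "'a::comm_semiring_1 poly"
  by (induction k) (simp_all add: pcompose_mult pcompose_1)

text \<open>The substitution z -> -1 - z turns z^k into (-1)^k (1 + z)^k, so on monomials this is
  negation of the upper index of a binomial coefficient. It yields the parity of the generating
  polynomial, since 1 + 2z only changes sign.\<close>

lemma binomial_functional_uminus:
  "binomial_functional (- x) p = - binomial_functional x (pcompose p [:- 1, - 1:])"
proof (rule poly_additive_eqI[where p = p])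
  fix c :: real and k
  have "pcompose (monom c k) [:- 1, - 1:] = smult c ([:- 1, - 1:] ^ k)"
    by (simp only: monom_altdef pcompose_smult pcompose_power) (simp add: pcompose_pCons)
  also have "\<dots> = smult c (smult (- 1) [:1, 1:] ^ k)" by simp
  also have "\<dots> = smult (c * (- 1) ^ k) (monom 1 0 * [:1, 1:] ^ k)"
    by (simp only: smult_power) (simp add: monom_0)
  finally have "pcompose (monom c k) [:- 1, - 1:] = smult (c * (- 1) ^ k) (monom 1 0 * [:1, 1:] ^ k)" .
  then show "binomial_functional (- x) (monom c k) =
      - binomial_functional x (pcompose (monom c k) [:- 1, - 1:])"
    by (simp only: binomial_functional_smult binomial_functional_monom_mult_power)
      (simp add: gbinomial_minus)
qed (simp_all only: binomial_functional_add pcompose_add minus_add_distrib)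

subsection \<open>Sums over long cycles\<close>

text \<open>
  The index is shifted: \<open>long_cycle_sum k\<close> ranges over the \<open>k!\<close> long cycles of \<open>{1..Suc k}\<close>.
\<close>

fun long_cycle_sum :: "nat \<Rightarrow> ((nat \<Rightarrow> nat) \<Rightarrow> 'b::comm_monoid_add) \<Rightarrow> 'b" where
  "long_cycle_sum 0 \<phi> = \<phi> id"
| "long_cycle_sum (Suc k) \<phi> =
    (\<Sum>j=1..Suc k. long_cycle_sum k (\<lambda>\<gamma>. \<phi> (\<gamma> \<circ> transpose j (Suc (Suc k)))))"

section \<open>The standard cycle and its conjugates\<close>

text \<open>The cycle (1 2 ... k+1), built as the term of \<open>long_cycle_sum\<close> in which j
  is largest at every stage.\<close>

fun std_cycle :: "nat \<Rightarrow> nat \<Rightarrow> nat" where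
  "std_cycle 0 = id"
| "std_cycle (Suc k) = std_cycle k \<circ> transpose (Suc k) (Suc (Suc k))"

lemma std_cycle_permutes: "std_cycle k permutes {1..Suc k}"
proof (induction k)
  case 0
  show ?case unfolding std_cycle.simps by (rule permutes_id)
next
  case (Suc k)
  have "std_cycle k permutes {1..Suc (Suc k)}"
    using Suc by (rule permutes_subset) auto
  then show ?case
    by (simp only: std_cycle.simps) (intro permutes_compose permutes_swap_id; simp)
qed

lemma std_cycle_less: "1 \<le> i \<Longrightarrow> i \<le> k \<Longrightarrow> std_cycle k i = Suc i"
proof (induction k)
  case (Suc k)
  show ?case
  proof (cases "i = Suc k")
    case True
    then show ?thesis
      using std_cycle_permutes[of k] by (simp add: permutes_not_in)
  next
    case False
    then show ?thesis using Suc by (simp add: transpose_def)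
  qed
qed simp

lemma std_cycle_last: "std_cycle k (Suc k) = 1"
  by (induction k) simp_all

text \<open>Every point of the cycle is thus the image of the largest point under a power of the
  cycle, that is, under a permutation commuting with it.\<close>

lemma std_cycle_funpow: "Suc i \<le> Suc k \<Longrightarrow> (std_cycle k ^^ Suc i) (Suc k) = Suc i"
proof (induction i)
  case (Suc i)
  then show ?case using std_cycle_less[of "Suc i" k] by simp
qed (simp add: std_cycle_last)

lemma conj_transpose:
  assumes "bij \<pi>"
  shows "\<pi> \<circ> transpose a b \<circ> inv \<pi> = transpose (\<pi> a) (\<pi> b)"
proof
  fix y
  obtain x where y: "y = \<pi> x" using assms by (metis bij_pointE)
  show "(\<pi> \<circ> transpose a b \<circ> inv \<pi>) y = transpose (\<pi> a) (\<pi> b) y"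
    using assms unfolding y by (simp add: transpose_def bij_is_inj inj_eq)
qed

text \<open>Replacing \<pi> by \<pi> \<circ> \<tau>, with \<tau> a power of the standard cycle, does
  not change the conjugate. The power is chosen so that \<kappa> = \<pi> \<circ> \<tau> sends
  \<open>Suc k\<close> to \<open>j\<close>; as \<kappa> fixes the new point, it also conjugates the
  new transposition correctly.\<close>

lemma std_cycle_conj_step:
  assumes \<pi>: "\<pi> permutes {1..Suc k}" and j: "j \<in> {1..Suc k}"
  shows "\<exists>\<kappa>. \<kappa> permutes {1..Suc (Suc k)} \<and>
    \<pi> \<circ> std_cycle k \<circ> inv \<pi> \<circ> transpose j (Suc (Suc k)) = \<kappa> \<circ> std_cycle (Suc k) \<circ> inv \<kappa>"
proof -
  let ?N = "Suc (Suc k)"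
  let ?c = "std_cycle k"
  have "inv \<pi> j \<in> {1..Suc k}" using j permutes_in_image[OF permutes_inv[OF \<pi>]] by blast
  then obtain i where i: "inv \<pi> j = Suc i" "Suc i \<le> Suc k" by (cases "inv \<pi> j") auto
  define \<tau> where "\<tau> = ?c ^^ Suc i"
  have \<tau>: "\<tau> permutes {1..Suc k}"
    unfolding \<tau>_def by (rule permutes_funpow[OF std_cycle_permutes])
  define \<kappa> where "\<kappa> = \<pi> \<circ> \<tau>"
  have \<kappa>0: "\<kappa> permutes {1..Suc k}" unfolding \<kappa>_def using \<tau> \<pi> by (rule permutes_compose)
  then have \<kappa>: "\<kappa> permutes {1..?N}" by (rule permutes_subset) auto
  have "\<kappa> (Suc k) = \<pi> (inv \<pi> j)"
    using std_cycle_funpow[OF i(2)] by (simp only: \<kappa>_def \<tau>_def comp_apply i(1))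
  then have kj: "\<kappa> (Suc k) = j" using permutes_inverses(1)[OF \<pi>] by simp
  have kN: "\<kappa> ?N = ?N" using \<kappa>0 by (simp add: permutes_not_in)
  have bk: "bij \<kappa>" and bt: "bij \<tau>" and bp: "bij \<pi>" using \<kappa>0 \<tau> \<pi> permutes_bij by blast+
  have "?c \<circ> \<tau> = \<tau> \<circ> ?c" unfolding \<tau>_def by (simp add: funpow_swap1 fun_eq_iff)
  then have c: "?c = \<tau> \<circ> ?c \<circ> inv \<tau>" using bt
    by (metis bij_is_surj comp_assoc comp_id surj_iff)
  have "\<kappa> \<circ> std_cycle (Suc k) \<circ> inv \<kappa> =
      (\<kappa> \<circ> ?c \<circ> inv \<kappa>) \<circ> (\<kappa> \<circ> transpose (Suc k) ?N \<circ> inv \<kappa>)"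
    using bk by (simp add: fun_eq_iff bij_is_inj)
  also have "\<kappa> \<circ> transpose (Suc k) ?N \<circ> inv \<kappa> = transpose j ?N"
    unfolding conj_transpose[OF bk] kj kN ..
  also have "\<kappa> \<circ> ?c \<circ> inv \<kappa> = \<pi> \<circ> (\<tau> \<circ> ?c \<circ> inv \<tau>) \<circ> inv \<pi>"
    unfolding \<kappa>_def o_inv_distrib[OF bp bt] by (simp only: comp_assoc)
  also have "\<tau> \<circ> ?c \<circ> inv \<tau> = ?c" by (rule c[symmetric])
  finally show ?thesis using \<kappa> by metis
qed

text \<open>By \<open>std_cycle_conj_step\<close>, every argument met in the recursion is a
  conjugate of the standard cycle.\<close>

lemma long_cycle_sum_cong_conj:
  assumes "\<And>\<pi>. \<pi> permutes {1..Suc k} \<Longrightarrow>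
    \<phi> (\<pi> \<circ> std_cycle k \<circ> inv \<pi>) = \<psi> (\<pi> \<circ> std_cycle k \<circ> inv \<pi>)"
  shows "long_cycle_sum k \<phi> = long_cycle_sum k \<psi>"
  using assms
proof (induction k arbitrary: \<phi> \<psi>)
  case 0
  then show ?case using 0[OF permutes_id] by (simp only: std_cycle.simps long_cycle_sum.simps comp_id inv_id)
next
  case (Suc k)
  show ?case unfolding long_cycle_sum.simps
  proof (intro sum.cong refl Suc.IH)
    fix j \<pi> assume "j \<in> {1..Suc k}" and "\<pi> permutes {1..Suc k}"
    then obtain \<kappa> where "\<kappa> permutes {1..Suc (Suc k)}" and
      eq: "\<pi> \<circ> std_cycle k \<circ> inv \<pi> \<circ> transpose j (Suc (Suc k)) = \<kappa> \<circ> std_cycle (Suc k) \<circ> inv \<kappa>"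
      using std_cycle_conj_step by blast
    then show "\<phi> (\<pi> \<circ> std_cycle k \<circ> inv \<pi> \<circ> transpose j (Suc (Suc k))) =
        \<psi> (\<pi> \<circ> std_cycle k \<circ> inv \<pi> \<circ> transpose j (Suc (Suc k)))"
      unfolding eq by (intro Suc.prems)
  qed
qed

lemma long_cycle_sum_cong:
  assumes "\<And>\<gamma>. \<gamma> permutes {1..Suc k} \<Longrightarrow> \<phi> \<gamma> = \<psi> \<gamma>"
  shows "long_cycle_sum k \<phi> = long_cycle_sum k \<psi>"
  by (intro long_cycle_sum_cong_conj assms permutes_compose permutes_inv std_cycle_permutes)

lemma long_cycle_sum_const: "long_cycle_sum k (\<lambda>_. c) = fact k * (c :: 'b::semiring_char_0)"
  by (induction k) (simp_all add: algebra_simps)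

lemma long_cycle_sum_mult:
  "long_cycle_sum k (\<lambda>\<gamma>. c * \<phi> \<gamma>) = (c :: 'b::comm_semiring_0) * long_cycle_sum k \<phi>"
  by (induction k arbitrary: \<phi>) (simp_all add: sum_distrib_left distrib_left)

lemma long_cycle_sum_sum:
  "long_cycle_sum k (\<lambda>\<gamma>. \<Sum>a\<in>A. \<phi> a \<gamma>) = (\<Sum>a\<in>A. long_cycle_sum k (\<phi> a))"
proof (induction k arbitrary: \<phi>)
  case 0
  show ?case by simp
next
  case (Suc k)
  show ?case unfolding long_cycle_sum.simps Suc by (rule sum.swap)
qed

section \<open>Evaluation of the sum over all long cycles\<close>

text \<open>Insertion into an existing cycle keeps the number of cycles, and a constant weight does
  not see their lengths.\<close>

lemma cycle_weight_const_insert: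
  assumes "\<sigma> permutes X" "finite X" "a \<notin> X" "m \<in> X"
  shows "cycle_weight (\<lambda>_. x) (insert a X) (transpose a m \<circ> \<sigma>) = cycle_weight (\<lambda>_. x) X \<sigma>"
  using cycle_weight_insert_into_cycle[OF assms, of "\<lambda>_. x"]
    cycle_weight_split_off[OF assms(1,2,4), of "\<lambda>_. x"] by simp

lemma cycle_weight_singleton: "\<rho> permutes {a} \<Longrightarrow> cycle_weight w {a} \<rho> = w (Suc 0)"
  using cycle_weight_insert_fixed[of \<rho> "{}" a w]
  by (simp add: permutes_sing cycle_weight_def)

lemma shift_poly_1: "shift_poly (Suc 0) = 1"
  by (simp add: shift_poly_def one_pCons)

theorem long_cycle_sum_cycle_weight:
  assumes "\<rho> permutes {1..Suc k}"
  shows "long_cycle_sum k (\<lambda>\<gamma>. cycle_weight (\<lambda>_. x) {1..Suc k} (\<rho> \<circ> \<gamma>)) =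
    fact k * binomial_functional x (class_poly {1..Suc k} \<rho>)"
  using assms
proof (induction k arbitrary: \<rho>)
  case 0
  have "cycle_weight (\<lambda>_. x) {1..Suc 0} \<rho> = x" "class_poly {1..Suc 0} \<rho> = 1"
    using 0 by (simp_all add: cycle_weight_singleton shift_poly_1)
  then show ?case
    using binomial_functional_monom[of x 1 0] by simp
next
  case (Suc k)
  define N X where "N = Suc (Suc k)" and "X = {1..Suc k}"
  let ?B = "binomial_functional x" and ?w = "\<lambda>_ :: nat. x"
  have X: "{1..Suc (Suc k)} = insert N X" "N \<notin> X" "finite X" "card X = Suc k"
    by (auto simp: N_def X_def)
  note IH = Suc.IH[folded X_def]
  have \<rho>: "\<rho> permutes insert N X" using Suc.prems X by simp
  \<comment> \<open>\<sigma> is \<rho> with \<open>N\<close> removed from its cycle; if \<rho> fixes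
    \<open>N\<close>, then \<open>m = N\<close> and \<sigma> = \<rho>.\<close>
  define m where "m = \<rho> N"
  define \<sigma> where "\<sigma> = transpose m N \<circ> \<rho>"
  have m: "m \<in> insert N X" unfolding m_def using permutes_in_image[OF \<rho>] by blast
  have "\<sigma> permutes insert N X"
    unfolding \<sigma>_def using m \<rho> by (intro permutes_compose permutes_swap_id) auto
  then have \<sigma>: "\<sigma> permutes X"
    by (rule permutes_superset) (auto simp: \<sigma>_def m_def)
  have \<rho>\<sigma>: "\<rho> = transpose m N \<circ> \<sigma>" by (simp add: \<sigma>_def comp_assoc[symmetric])
  \<comment> \<open>Conjugation by the transposition moves it from the right end to the left end of
    the product.\<close>
  have "cycle_weight ?w (insert N X) (\<rho> \<circ> (\<gamma> \<circ> transpose j N)) =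
      cycle_weight ?w (insert N X) (transpose j N \<circ> \<rho> \<circ> \<gamma>)"
    if \<gamma>: "\<gamma> permutes X" and j: "j \<in> X" for \<gamma> j
  proof -
    have t: "transpose j N permutes insert N X" using j by (intro permutes_swap_id) auto
    have "\<gamma> permutes insert N X" using \<gamma> by (rule permutes_subset) auto
    then have "\<rho> \<circ> (\<gamma> \<circ> transpose j N) permutes insert N X"
      using t \<rho> by (intro permutes_compose)
    from cycle_weight_conj[OF this _ t, of ?w] show ?thesis
      using X(3) by (simp add: comp_assoc inv_unique_comp)
  qed
  then have L: "long_cycle_sum (Suc k) (\<lambda>\<gamma>. cycle_weight ?w {1..Suc (Suc k)} (\<rho> \<circ> \<gamma>)) =
      (\<Sum>j\<in>X. long_cycle_sum k (\<lambda>\<gamma>. cycle_weight ?w (insert N X) (transpose j N \<circ> \<rho> \<circ> \<gamma>)))"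
    unfolding long_cycle_sum.simps X(1) unfolding N_def[symmetric] X_def[symmetric]
    by (intro sum.cong refl long_cycle_sum_cong) (simp add: X_def)
  show ?case
  proof (cases "m = N")
    case True
    then have "\<sigma> = \<rho>" by (simp add: \<sigma>_def)
    \<comment> \<open>Here \<open>N\<close> is fixed by \<rho> \<circ> \<gamma> and is inserted into
      the cycle of \<open>j\<close>, so all \<open>Suc k\<close> choices of \<open>j\<close> give
      the same sum.\<close>
    have "cycle_weight ?w (insert N X) (transpose j N \<circ> \<rho> \<circ> \<gamma>) = cycle_weight ?w X (\<rho> \<circ> \<gamma>)"
      if "\<gamma> permutes X" "j \<in> X" for \<gamma> j
      using cycle_weight_const_insert[of "\<sigma> \<circ> \<gamma>" X N j x] that \<sigma> X permutes_compose[OF that(1) \<sigma>]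
      by (simp add: \<open>\<sigma> = \<rho>\<close> comp_assoc transpose_commute)
    then have "long_cycle_sum k (\<lambda>\<gamma>. cycle_weight ?w (insert N X) (transpose j N \<circ> \<rho> \<circ> \<gamma>)) =
        fact k * ?B (class_poly X \<rho>)" if "j \<in> X" for j
      unfolding IH[OF \<sigma>, unfolded \<open>\<sigma> = \<rho>\<close>, symmetric]
      using that by (intro long_cycle_sum_cong) (simp add: X_def)
    then have "(\<Sum>j\<in>X. long_cycle_sum k
        (\<lambda>\<gamma>. cycle_weight ?w (insert N X) (transpose j N \<circ> \<rho> \<circ> \<gamma>))) =
        real (Suc k) * (fact k * ?B (class_poly X \<rho>))"
      using X(4) by simp
    moreover have "class_poly (insert N X) \<rho> = class_poly X \<rho>"
      using cycle_weight_insert_fixed[OF \<sigma>, of N shift_poly] X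
      by (simp add: \<open>\<sigma> = \<rho>\<close> shift_poly_1)
    ultimately show ?thesis
      unfolding L unfolding X(1) by (simp add: algebra_simps)
  next
    case False
    then have mX: "m \<in> X" using m by simp
    \<comment> \<open>For \<open>j = m\<close> the transposition cancels the one in \<rho>;
      \<open>N\<close> becomes a cycle of its own and contributes the factor
      \<open>x\<close>.\<close>
    have "cycle_weight ?w (insert N X) (transpose m N \<circ> \<rho> \<circ> \<gamma>) = x * cycle_weight ?w X (\<sigma> \<circ> \<gamma>)"
      if "\<gamma> permutes X" for \<gamma>
      using cycle_weight_insert_fixed[OF permutes_compose[OF that \<sigma>], of N ?w] X
      by (simp add: \<sigma>_def)
    then have 1: "long_cycle_sum k (\<lambda>\<gamma>. cycle_weight ?w (insert N X) (transpose m N \<circ> \<rho> \<circ> \<gamma>)) =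
        x * (fact k * ?B (class_poly X \<sigma>))"
      unfolding IH[OF \<sigma>, symmetric] long_cycle_sum_mult[symmetric]
      by (intro long_cycle_sum_cong) (simp add: X_def)
    have 2: "long_cycle_sum k (\<lambda>\<gamma>. cycle_weight ?w (insert N X) (transpose j N \<circ> \<rho> \<circ> \<gamma>)) =
        fact k * ?B (class_poly X (transpose j m \<circ> \<sigma>))" if j: "j \<in> X - {m}" for j
    proof -
      \<comment> \<open>In this form the outer transposition merely inserts \<open>N\<close> into
        the cycle of \<open>m\<close>, which keeps the number of cycles.\<close>
      have "transpose j N \<circ> transpose m N = transpose N m \<circ> transpose j m"
        using j mX X(2) by (auto simp: transpose_def fun_eq_iff)
      then have e: "transpose j N \<circ> \<rho> \<circ> \<gamma> = transpose N m \<circ> ((transpose j m \<circ> \<sigma>) \<circ> \<gamma>)" for \<gamma>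
        unfolding \<rho>\<sigma> by (metis comp_assoc)
      have p: "transpose j m \<circ> \<sigma> permutes X"
        using j mX \<sigma> by (intro permutes_compose permutes_swap_id) auto
      show ?thesis unfolding IH[OF p, symmetric] e
        using cycle_weight_const_insert[OF permutes_compose[OF _ p] X(3) X(2) mX]
        by (intro long_cycle_sum_cong) (simp add: X_def)
    qed
    have "long_cycle_sum (Suc k) (\<lambda>\<gamma>. cycle_weight ?w {1..Suc (Suc k)} (\<rho> \<circ> \<gamma>)) =
        x * (fact k * ?B (class_poly X \<sigma>)) +
        (\<Sum>j\<in>X - {m}. fact k * ?B (class_poly X (transpose j m \<circ> \<sigma>)))"
      unfolding L sum.remove[OF X(3) mX] 1 using 2 by simp
    also have "\<dots> = fact k * (?B (pderiv ([:0, 1, 1:] * class_poly X \<sigma>)) +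
        ?B (\<Sum>j\<in>X - {m}. class_poly X (transpose j m \<circ> \<sigma>)))"
      unfolding mult_binomial_functional[symmetric] binomial_functional_sum
      by (simp add: sum_distrib_left algebra_simps)
    also have "\<dots> = fact k * (of_nat (Suc k) *
        ?B (shift_poly (Suc (card (orbit \<sigma> m))) * class_poly (X - orbit \<sigma> m) \<sigma>))"
      unfolding binomial_functional_add[symmetric] class_poly_recurrence[OF \<sigma> X(3) mX]
        binomial_functional_of_nat_mult X(4) ..
    also have "shift_poly (Suc (card (orbit \<sigma> m))) * class_poly (X - orbit \<sigma> m) \<sigma> =
        class_poly (insert N X) \<rho>"
      unfolding \<rho>\<sigma> transpose_commute[of m N]
      by (rule cycle_weight_insert_into_cycle[OF \<sigma> X(3,2) mX, symmetric])
    finally show ?thesis unfolding X(1) by (simp add: algebra_simps)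
  qed
qed

subsection \<open>Fixed-point-free involutions\<close>

text \<open>Arbitrary sets are allowed because the counting recursion removes a point together with
  its partner.\<close>

definition fpf_involutions :: "'a set \<Rightarrow> ('a \<Rightarrow> 'a) set" where
  "fpf_involutions X = {\<alpha>. \<alpha> permutes X \<and> \<alpha> \<circ> \<alpha> = id \<and> (\<forall>i\<in>X. \<alpha> i \<noteq> i)}"

lemma fpf_involutionsD:
  assumes "\<alpha> \<in> fpf_involutions X"
  shows "\<alpha> permutes X" "\<alpha> (\<alpha> x) = x" "x \<in> X \<Longrightarrow> \<alpha> x \<noteq> x" "inv \<alpha> = \<alpha>"
proof -
  have \<alpha>: "\<alpha> permutes X" "\<alpha> \<circ> \<alpha> = id" "\<forall>i\<in>X. \<alpha> i \<noteq> i"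
    using assms by (simp_all add: fpf_involutions_def)
  show "\<alpha> permutes X" "\<alpha> (\<alpha> x) = x" "x \<in> X \<Longrightarrow> \<alpha> x \<noteq> x" "inv \<alpha> = \<alpha>"
    using \<alpha> inv_unique_comp[OF \<alpha>(2,2)] by (auto dest: fun_cong)
qed

lemma finite_fpf_involutions: "finite X \<Longrightarrow> finite (fpf_involutions X)"
  by (rule finite_subset[OF _ finite_permutations]) (auto simp: fpf_involutions_def)

text \<open>Involutions are sorted by the partner \<open>b\<close> of \<open>a\<close>. Composition
  with the transposition of \<open>a\<close> and \<open>b\<close> makes both points fixed, or pairs
  them up again.\<close>

lemma card_fpf_involutions_step:
  assumes fin: "finite X" and a: "a \<in> X"
  shows "card (fpf_involutions X) = (\<Sum>b\<in>X - {a}. card (fpf_involutions (X - {a, b})))"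
proof -
  let ?S = "SIGMA b:X - {a}. fpf_involutions (X - {a, b})"
  have "bij_betw (\<lambda>(b, \<alpha>). transpose a b \<circ> \<alpha>) ?S (fpf_involutions X)"
  proof (rule bij_betw_byWitness[where f' = "\<lambda>\<alpha>. (\<alpha> a, transpose a (\<alpha> a) \<circ> \<alpha>)"])
    have fx: "\<alpha> a = a" "\<alpha> b = b" if "\<alpha> \<in> fpf_involutions (X - {a, b})" for \<alpha> b
      using fpf_involutionsD(1)[OF that] by (simp_all add: permutes_not_in)
    show "\<forall>s\<in>?S. (\<lambda>\<alpha>. (\<alpha> a, transpose a (\<alpha> a) \<circ> \<alpha>)) ((\<lambda>(b, \<alpha>). transpose a b \<circ> \<alpha>) s) = s"
    proof
      fix s assume "s \<in> ?S"
      then obtain b \<alpha> where s: "s = (b, \<alpha>)" and "\<alpha> \<in> fpf_involutions (X - {a, b})" by auto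
      from fx[OF this(2)] show "(\<lambda>\<alpha>. (\<alpha> a, transpose a (\<alpha> a) \<circ> \<alpha>))
          ((\<lambda>(b, \<alpha>). transpose a b \<circ> \<alpha>) s) = s"
        unfolding s by (simp add: comp_assoc[symmetric])
    qed
    show "\<forall>\<alpha>\<in>fpf_involutions X. (\<lambda>(b, \<alpha>). transpose a b \<circ> \<alpha>) (\<alpha> a, transpose a (\<alpha> a) \<circ> \<alpha>) = \<alpha>"
      by (auto simp: comp_assoc[symmetric])
    show "(\<lambda>(b, \<alpha>). transpose a b \<circ> \<alpha>) ` ?S \<subseteq> fpf_involutions X"
    proof (rule image_subsetI)
      fix s assume "s \<in> ?S"
      moreover obtain b \<alpha> where s: "s = (b, \<alpha>)" by (cases s)
      ultimately have b: "b \<in> X" "b \<noteq> a" and \<alpha>: "\<alpha> \<in> fpf_involutions (X - {a, b})"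
        by simp_all
      note D = fpf_involutionsD[OF \<alpha>] and F = fx[OF \<alpha>]
      have off: "\<alpha> x \<noteq> a \<and> \<alpha> x \<noteq> b" if "x \<noteq> a" "x \<noteq> b" for x using D(2) F that by metis
      have "\<alpha> permutes X" using D(1) by (rule permutes_subset) auto
      then have "transpose a b \<circ> \<alpha> permutes X"
        using a b by (intro permutes_compose permutes_swap_id) auto
      moreover have "transpose a b (\<alpha> (transpose a b (\<alpha> x))) = x" for x
      proof (cases "x = a \<or> x = b")
        case True
        then show ?thesis using F by auto
      next
        case False
        then show ?thesis using off[of x] D(2)[of x] by simp
      qed
      moreover have "transpose a b (\<alpha> x) \<noteq> x" if "x \<in> X" for x
      proof (cases "x = a \<or> x = b")
        case True
        then show ?thesis using F b by auto
      next
        case False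
        then show ?thesis using off[of x] D(3)[of x] that by simp
      qed
      ultimately have "transpose a b \<circ> \<alpha> \<in> fpf_involutions X"
        unfolding fpf_involutions_def mem_Collect_eq fun_eq_iff comp_apply id_apply by blast
      then show "(\<lambda>(b, \<alpha>). transpose a b \<circ> \<alpha>) s \<in> fpf_involutions X"
        by (simp add: s)
    qed
    show "(\<lambda>\<alpha>. (\<alpha> a, transpose a (\<alpha> a) \<circ> \<alpha>)) ` fpf_involutions X \<subseteq> ?S"
    proof (rule image_subsetI)
      fix \<alpha> assume \<alpha>: "\<alpha> \<in> fpf_involutions X"
      note D = fpf_involutionsD[OF \<alpha>]
      define b where "b = \<alpha> a"
      have b: "b \<in> X" "b \<noteq> a" using D(3)[OF a] a permutes_in_image[OF D(1)] by (auto simp: b_def)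
      have F: "\<alpha> a = b" "\<alpha> b = a" using D(2) by (simp_all add: b_def)
      have off: "\<alpha> x \<noteq> a \<and> \<alpha> x \<noteq> b" if "x \<noteq> a" "x \<noteq> b" for x using D(2) F that by metis
      have "transpose a b \<circ> \<alpha> permutes X"
        using a b D(1) by (intro permutes_compose permutes_swap_id) auto
      then have "transpose a b \<circ> \<alpha> permutes X - {a, b}"
        by (rule permutes_superset) (auto simp: F)
      moreover have "transpose a b (\<alpha> (transpose a b (\<alpha> x))) = x" for x
      proof (cases "x = a \<or> x = b")
        case True
        then show ?thesis using F by auto
      next
        case False
        then show ?thesis using off[of x] D(2)[of x] by simp
      qed
      moreover have "transpose a b (\<alpha> x) \<noteq> x" if "x \<in> X - {a, b}" for x
        using D(3)[of x] off[of x] that by simp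
      ultimately have "transpose a b \<circ> \<alpha> \<in> fpf_involutions (X - {a, b})"
        unfolding fpf_involutions_def mem_Collect_eq fun_eq_iff comp_apply id_apply by blast
      then show "(\<alpha> a, transpose a (\<alpha> a) \<circ> \<alpha>) \<in> ?S" using b by (simp add: b_def)
    qed
  qed
  then have "card (fpf_involutions X) = card ?S" by (rule bij_betw_same_card[symmetric])
  then show ?thesis using fin by (simp add: card_SigmaI finite_fpf_involutions)
qed

lemma card_fpf_involutions:
  assumes "finite X" "card X = 2 * n"
  shows "card (fpf_involutions X) * (2 ^ n * fact n) = fact (2 * n)"
  using assms
proof (induction n arbitrary: X)
  case 0
  then have "fpf_involutions X = {id}" by (auto simp: fpf_involutions_def)
  then show ?case by simp
next
  case (Suc n)
  then obtain a where a: "a \<in> X" by fastforce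
  let ?c = "\<lambda>b. card (fpf_involutions (X - {a, b}))"
  have "?c b * (2 ^ n * fact n) = fact (2 * n)" if "b \<in> X - {a}" for b
    using Suc.prems a that by (intro Suc.IH) (auto simp: card_Diff_subset)
  then have "(\<Sum>b\<in>X - {a}. ?c b) * (2 ^ n * fact n) = (2 * n + 1) * fact (2 * n)"
    using Suc.prems a by (simp add: sum_distrib_right)
  then have "card (fpf_involutions X) * (2 ^ n * fact n) = (2 * n + 1) * fact (2 * n)"
    using card_fpf_involutions_step[OF Suc.prems(1) a] by simp
  \<comment> \<open>The factor 2 (n + 1) completes (2n + 1) (2n)! to (2n + 2)! and 2^n n! to 2^(n+1)
    (n+1)!.\<close>
  then have "2 * (n + 1) * (card (fpf_involutions X) * (2 ^ n * fact n)) =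
      2 * (n + 1) * ((2 * n + 1) * fact (2 * n))" by (rule arg_cong)
  then show ?case by (simp add: algebra_simps)
qed

lemma class_poly_fpf_involution:
  assumes \<alpha>: "\<alpha> \<in> fpf_involutions X" and X: "finite X" "card X = 2 * n"
  shows "class_poly X \<alpha> = [:1, 2:] ^ n"
proof -
  note D = fpf_involutionsD[OF \<alpha>]
  have p: "permutation \<alpha>" using D(1) X permutation_permutes by blast
  have "orbit \<alpha> x = {x, \<alpha> x}" for x
  proof -
    \<comment> \<open>Outside \<open>X\<close> both listed values coincide, which
      \<open>orbit_eq_image\<close> permits.\<close>
    have "orbit \<alpha> x = (\<lambda>i. if i = 0 then x else \<alpha> x) ` {..<2 :: nat}"
      by (rule orbit_eq_image) (simp_all add: D(2))
    also have "{..<2 :: nat} = {0, 1}" by auto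
    finally show ?thesis by auto
  qed
  then have "card (orbit \<alpha> x) = 2" if "x \<in> X" for x
    using D(3)[OF that] by (metis card_2_iff)
  then have c: "card C = 2" if "C \<in> orbit \<alpha> ` X" for C
    using that by blast
  have "card X = (\<Sum>x\<in>X. 1)" by simp
  also have "\<dots> = (\<Sum>C\<in>orbit \<alpha> ` X. of_nat (card C) * 1)"
    using sum_over_orbits[OF p X(1), of "\<lambda>_. 1 :: nat"] permutes_orbit_subset[OF D(1)] by simp
  also have "\<dots> = 2 * card (orbit \<alpha> ` X)" using c by simp
  finally have "card (orbit \<alpha> ` X) = n" using X by simp
  moreover have "shift_poly 2 = [:1, 2:]" by (simp add: shift_poly_def power2_eq_square)
  ultimately show ?thesis unfolding cycle_weight_def using c by simp
qed

lemma bij_betw_conj_fpf_involutions: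
  assumes \<pi>: "\<pi> permutes X"
  shows "bij_betw (\<lambda>\<alpha>. \<pi> \<circ> \<alpha> \<circ> inv \<pi>) (fpf_involutions X) (fpf_involutions X)"
proof (rule bij_betw_byWitness[where f' = "\<lambda>\<alpha>. inv \<pi> \<circ> \<alpha> \<circ> \<pi>"])
  have sub: "\<pi> \<circ> \<alpha> \<circ> inv \<pi> \<in> fpf_involutions X"
    if \<pi>: "\<pi> permutes X" and \<alpha>: "\<alpha> \<in> fpf_involutions X" for \<pi> \<alpha>
  proof -
    note D = fpf_involutionsD[OF \<alpha>] and i = permutes_inverses[OF \<pi>]
    have "\<pi> \<circ> \<alpha> \<circ> inv \<pi> permutes X"
      using D(1) \<pi> by (intro permutes_compose permutes_inv)
    moreover have "\<pi> (\<alpha> (inv \<pi> x)) \<noteq> x" if "x \<in> X" for x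
      using D(3)[of "inv \<pi> x"] that permutes_in_image[OF permutes_inv[OF \<pi>]] i by metis
    ultimately show ?thesis using D(2) i by (simp add: fpf_involutions_def fun_eq_iff)
  qed
  show "(\<lambda>\<alpha>. \<pi> \<circ> \<alpha> \<circ> inv \<pi>) ` fpf_involutions X \<subseteq> fpf_involutions X"
    using sub[OF \<pi>] by blast
  show "(\<lambda>\<alpha>. inv \<pi> \<circ> \<alpha> \<circ> \<pi>) ` fpf_involutions X \<subseteq> fpf_involutions X"
    using sub[OF permutes_inv[OF \<pi>]] by (auto simp: permutes_inv_inv[OF \<pi>])
qed (use permutes_inverses[OF \<pi>] in \<open>simp_all add: fun_eq_iff\<close>)

text \<open>The double sum over involutions and long cycles is evaluated twice. The inner sum over
  involutions is the same for each long cycle, giving \<open>fact k\<close> equal terms; the inner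
  sum over long cycles is known for each involution. The factor \<open>fact k\<close>
  cancels.\<close>

theorem sum_fpf_involutions_cycle_weight:
  assumes k: "Suc k = 2 * n"
  shows "(\<Sum>\<alpha>\<in>fpf_involutions {1..Suc k}. cycle_weight (\<lambda>_. x) {1..Suc k} (\<alpha> \<circ> std_cycle k)) =
    real (card (fpf_involutions {1..Suc k})) * binomial_functional x ([:1, 2:] ^ n)"
proof -
  define X where "X = {1..Suc k}"
  have fin: "finite X" "card X = 2 * n" using k by (simp_all add: X_def)
  let ?I = "fpf_involutions X" and ?W = "cycle_weight (\<lambda>_. x) X"
  let ?S = "\<lambda>\<gamma>. \<Sum>\<alpha>\<in>?I. ?W (\<alpha> \<circ> \<gamma>)"
  have "?S (\<pi> \<circ> std_cycle k \<circ> inv \<pi>) = ?S (std_cycle k)" if \<pi>: "\<pi> permutes X" for \<pi>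
  proof -
    have "?S (\<pi> \<circ> std_cycle k \<circ> inv \<pi>) =
        (\<Sum>\<alpha>\<in>?I. ?W ((\<pi> \<circ> \<alpha> \<circ> inv \<pi>) \<circ> (\<pi> \<circ> std_cycle k \<circ> inv \<pi>)))"
      using bij_betw_conj_fpf_involutions[OF \<pi>] by (rule sum.reindex_bij_betw[symmetric])
    also have "\<dots> = (\<Sum>\<alpha>\<in>?I. ?W (\<pi> \<circ> (\<alpha> \<circ> std_cycle k) \<circ> inv \<pi>))"
      using permutes_inverses[OF \<pi>] by (simp add: comp_def)
    also have "\<dots> = ?S (std_cycle k)"
      using fpf_involutionsD(1) std_cycle_permutes[of k, folded X_def] fin(1) \<pi>
      by (intro sum.cong refl cycle_weight_conj permutes_compose)
    finally show ?thesis .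
  qed
  then have "long_cycle_sum k ?S = long_cycle_sum k (\<lambda>_. ?S (std_cycle k))"
    by (intro long_cycle_sum_cong_conj) (simp add: X_def)
  also have "\<dots> = fact k * ?S (std_cycle k)" by (rule long_cycle_sum_const)
  finally have "fact k * ?S (std_cycle k) = (\<Sum>\<alpha>\<in>?I. long_cycle_sum k (\<lambda>\<gamma>. ?W (\<alpha> \<circ> \<gamma>)))"
    by (simp only: long_cycle_sum_sum)
  also have "\<dots> = (\<Sum>\<alpha>\<in>?I. fact k * binomial_functional x (class_poly X \<alpha>))"
    unfolding X_def
    by (intro sum.cong refl long_cycle_sum_cycle_weight fpf_involutionsD(1))
  also have "\<dots> = fact k * (real (card ?I) * binomial_functional x ([:1, 2:] ^ n))"
    using fin by (simp add: class_poly_fpf_involution)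
  finally show ?thesis by (simp add: X_def)
qed

subsection \<open>The shift operator and the final count\<close>

lemma long_cycle_eq_std_cycle:
  assumes "n > 0"
  shows "long_cycle n = std_cycle (2 * n - 1)"
proof
  fix i
  have p: "std_cycle (2 * n - 1) permutes {1..2 * n}"
    using std_cycle_permutes[of "2 * n - 1"] assms by simp
  consider "1 \<le> i" "i < 2 * n" | "i = 2 * n" | "i \<notin> {1..2 * n}" by force
  then show "long_cycle n i = std_cycle (2 * n - 1) i"
  proof cases
    case 1
    then show ?thesis using std_cycle_less[of i "2 * n - 1"] by (simp add: long_cycle_step)
  next
    case 2
    then show ?thesis
      using std_cycle_last[of "2 * n - 1"] assms by (simp add: long_cycle_last)
  next
    case 3
    then show ?thesis using permutes_not_in[OF p] permutes_not_in[OF long_cycle_permutes[of n]] by simp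
  qed
qed

text \<open>Each application of 1 + E trades a factor 1 + z for a factor 1 + 2z;
  \<open>k \<le> n\<close> ensures that one is left to trade. The point \<open>x\<close> varies in
  the induction because E evaluates at \<open>x - 1\<close>.\<close>

lemma poly_shift_power_falling_factorial:
  assumes "k \<le> n"
  shows "poly (((\<lambda>f. f + backward_shift f) ^^ k) (falling_factorial [:of_nat n, 1:] (n + 1))) x =
    fact (n + 1) * binomial_functional x ([:1, 1:] ^ (n - k) * [:1, 2:] ^ k)"
  using assms
proof (induction k arbitrary: x)
  case 0
  have "poly (falling_factorial [:of_nat n, 1:] (n + 1)) x = (\<Prod>i=0..<n + 1. (x + real n) - of_nat i)"
    unfolding falling_factorial_def poly_prod
    by (intro prod.cong) (auto simp: of_nat_poly)
  also have "\<dots> = fact (n + 1) * ((x + real n) gchoose (n + 1))"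
    by (rule gbinomial_mult_fact[symmetric])
  finally show ?case
    using binomial_functional_monom_mult_power[of x 0 n] by simp
next
  case (Suc k)
  let ?B = binomial_functional and ?p = "[:1, 1:] ^ (n - Suc k) * [:1, 2:] ^ k :: real poly"
  have e: "[:1, 1:] ^ (n - k) * [:1, 2:] ^ k = [:1, 1:] * ?p"
  proof -
    have "n - k = Suc (n - Suc k)" using Suc.prems by simp
    then show ?thesis by (simp only: power_Suc mult.assoc)
  qed
  have "?B x ([:1, 1:] * ?p) + ?B (x - 1) ([:1, 1:] * ?p) = ?B x (([:1, 1:] + [:0, 1:]) * ?p)"
    unfolding binomial_functional_shift distrib_right binomial_functional_add ..
  also have "[:1, 1:] + [:0, 1:] = [:1, 2 :: real:]" by simp
  also have "[:1, 2:] * ?p = [:1, 1:] ^ (n - Suc k) * [:1, 2:] ^ Suc k"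
    unfolding power_Suc by (rule mult.left_commute)
  finally show ?case
    using Suc e by (simp add: poly_backward_shift distrib_left[symmetric] del: power_Suc)
qed

section \<open>Degree bounds and the sorting of involutions by genus\<close>

lemma degree_shift_power:
  "degree (((\<lambda>f. f + backward_shift f) ^^ k) p) \<le> degree p"
proof (induction k)
  case (Suc k)
  have "degree (backward_shift f) = degree f" for f
    by (simp add: backward_shift_def degree_pcompose)
  then show ?case using Suc by (auto intro: degree_add_le)
qed simp

lemma degree_falling_factorial: "degree (falling_factorial [:c, 1 :: real:] m) \<le> m"
proof -
  have "degree (\<Prod>i<m. [:c, 1:] - of_nat i) \<le> (\<Sum>i<m. degree ([:c, 1:] - of_nat i))"
    using degree_prod_sum_le[of "{..<m}" "\<lambda>i. [:c, 1:] - of_nat i"] by (simp add: comp_def)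
  also have "\<dots> \<le> (\<Sum>i<m. 1)"
    by (intro sum_mono degree_diff_le) simp_all
  finally show ?thesis by (simp add: falling_factorial_def)
qed

theorem proposition3p1:
  fixes n :: nat
  shows "(\<Sum>g. monom (of_nat (num_maps n g) :: real) (n + 1 - 2 * g)) =
    smult (fact (2 * n) / (2 ^ n * fact n * fact (n + 1)))
      (((\<lambda>f. f + backward_shift f) ^^ n) (falling_factorial [:of_nat n, 1:] (n + 1)))"
    (is "?L = ?R")
proof (cases "n = 0")
  case True
  \<comment> \<open>The map without edges is treated apart, since its vertex is a convention and not
    a cycle.\<close>
  have "?L = (\<Sum>g\<in>{0}. monom (of_nat (num_maps n g) :: real) (n + 1 - 2 * g))"
    by (rule Sum_any.expand_superset) (auto simp: True num_maps_0)
  then show ?thesis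
    by (simp add: True num_maps_0 falling_factorial_def monom_altdef)
next
  case False
  \<comment> \<open>Since each \<alpha> in \<open>I\<close> is its own inverse,
    \<open>v \<alpha>\<close> is the number of vertices of its map.\<close>
  define X I v where "X = {1..2 * n}" and "I = fpf_involutions X"
    and "v \<alpha> = card (orbit (\<alpha> \<circ> long_cycle n) ` X)" for \<alpha>
  define P :: "real poly" where "P = (\<Sum>\<alpha>\<in>I. monom 1 (v \<alpha>))"
  have finI: "finite I" by (simp add: I_def X_def finite_fpf_involutions)
  have "real (card I * (2 ^ n * fact n)) = real (fact (2 * n))"
    unfolding I_def X_def by (subst card_fpf_involutions) simp_all
  then have cI: "real (card I) = fact (2 * n) / (2 ^ n * fact n)"
    by (simp add: field_simps)
  have P: "poly P x = real (card I) * binomial_functional x ([:1, 2:] ^ n)" for x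
  proof -
    have "poly P x = (\<Sum>\<alpha>\<in>I. cycle_weight (\<lambda>_. x) X (\<alpha> \<circ> long_cycle n))"
      by (simp add: P_def poly_sum poly_monom cycle_weight_def v_def)
    then show ?thesis
      using sum_fpf_involutions_cycle_weight[of "2 * n - 1" n x] False
      by (simp add: I_def X_def long_cycle_eq_std_cycle)
  qed
  \<comment> \<open>For \<open>k = n\<close> no factor 1 + z is left, and (n + 1)! cancels against
    the denominator.\<close>
  have "poly P x = poly ?R x" for x
    using poly_shift_power_falling_factorial[of n n x] unfolding P cI by simp
  then have PR: "P = ?R" by (simp add: poly_eq_poly_eq_iff[symmetric] fun_eq_iff)
  have coeff: "coeff P m = real (card {\<alpha> \<in> I. v \<alpha> = m})" for m
    using finI by (simp add: P_def coeff_sum sum.If_cases Int_def)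
  have pos: "coeff P (v \<alpha>) \<noteq> 0" if "\<alpha> \<in> I" for \<alpha>
    using that finI by (auto simp: coeff)
  txt \<open>
    The coefficients of \<open>P\<close> are cardinalities, so its degree and its parity under \<open>x \<mapsto> -x\<close>, read off the
    closed form, show that every involution has a genus.
  \<close>
  have "degree P \<le> n + 1"
    unfolding PR
    by (rule order_trans[OF degree_smult_le order_trans[OF degree_shift_power degree_falling_factorial]])
  then have v_le: "v \<alpha> \<le> n + 1" if "\<alpha> \<in> I" for \<alpha>
    using le_degree[OF pos[OF that]] by simp
  have neg: "poly P (- x) = (- 1) ^ (n + 1) * poly P x" for x
  proof -
    have "pcompose ([:1, 2:] ^ n) [:- 1, - 1:] = [:- 1, - 2 :: real:] ^ n"
      unfolding pcompose_power by (simp add: pcompose_pCons)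
    also have "\<dots> = smult (- 1) [:1, 2:] ^ n" by simp
    also have "\<dots> = smult ((- 1) ^ n) ([:1, 2:] ^ n)" by (rule smult_power)
    finally show ?thesis
      unfolding P binomial_functional_uminus by (simp add: binomial_functional_smult)
  qed
  have parity: "even (n + 1 - v \<alpha>)" if \<alpha>: "\<alpha> \<in> I" for \<alpha>
  proof -
    \<comment> \<open>\<open>Q\<close> is P(-x) - (-1)^(n+1) P(x), hence zero by \<open>neg\<close>.
      Its coefficient at \<open>v \<alpha>\<close> vanishes only if \<open>v \<alpha>\<close> and
      \<open>n + 1\<close> have the same parity, as that of \<open>P\<close> is nonzero.\<close>
    define Q :: "real poly" where "Q = (\<Sum>\<alpha>\<in>I. monom ((- 1) ^ v \<alpha> - (- 1) ^ (n + 1)) (v \<alpha>))"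
    have "poly Q x = poly P (- x) - (- 1) ^ (n + 1) * poly P x" for x
    proof -
      have "((- 1) ^ m - (- 1) ^ (n + 1)) * x ^ m = (- x) ^ m - (- 1) ^ (n + 1) * x ^ m" for m
        by (simp add: power_minus[of x] algebra_simps)
      then show ?thesis
        by (simp only: Q_def P_def poly_sum poly_monom sum_subtractf sum_distrib_left mult_1_left)
    qed
    then have "Q = 0" unfolding neg by (simp add: poly_eq_poly_eq_iff[symmetric] fun_eq_iff)
    moreover have "coeff Q (v \<alpha>) = ((- 1) ^ v \<alpha> - (- 1) ^ (n + 1)) * coeff P (v \<alpha>)"
      unfolding Q_def P_def coeff_sum sum_distrib_left by (intro sum.cong) auto
    ultimately have "(- 1 :: real) ^ v \<alpha> = (- 1) ^ (n + 1)" using pos[OF \<alpha>] by simp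
    then show ?thesis
      using v_le[OF \<alpha>] by (auto simp: minus_one_power_iff split: if_splits)
  qed
  \<comment> \<open>On \<open>I\<close> the subtraction is not truncated, by \<open>v_le\<close>,
    and the division is exact, by \<open>parity\<close>.\<close>
  define genus where "genus \<alpha> = (n + 1 - v \<alpha>) div 2" for \<alpha>
  have genus: "v \<alpha> + 2 * genus \<alpha> = n + 1" if "\<alpha> \<in> I" for \<alpha>
    using parity[OF that] v_le[OF that] by (simp add: genus_def)
  have count: "num_maps n g = card {\<alpha> \<in> I. genus \<alpha> = g}" for g
  proof -
    have "{\<alpha>. fpf_involution n \<alpha> \<and> card (orbit (inv \<alpha> \<circ> long_cycle n) ` {1..2 * n}) + 2 * g = n + 1} =
        {\<alpha> \<in> I. v \<alpha> + 2 * g = n + 1}"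
    proof (rule Collect_cong)
      fix \<alpha>
      have "fpf_involution n \<alpha> \<longleftrightarrow> \<alpha> \<in> I"
        by (simp add: I_def X_def fpf_involution_def fpf_involutions_def)
      moreover have "inv \<alpha> = \<alpha>" if "\<alpha> \<in> I"
        using fpf_involutionsD(4) that unfolding I_def .
      ultimately show "(fpf_involution n \<alpha> \<and>
          card (orbit (inv \<alpha> \<circ> long_cycle n) ` {1..2 * n}) + 2 * g = n + 1) \<longleftrightarrow>
          (\<alpha> \<in> I \<and> v \<alpha> + 2 * g = n + 1)"
        unfolding v_def X_def by (cases "\<alpha> \<in> I") simp_all
    qed
    also have "\<dots> = {\<alpha> \<in> I. genus \<alpha> = g}" using genus by force
    finally show ?thesis using False by (simp add: num_maps_eq_card_involutions)
  qed
  \<comment> \<open>Values of g that are not attained contribute zero; the remaining sum is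
    \<open>P\<close> with its terms grouped by genus.\<close>
  have "?L = (\<Sum>g\<in>genus ` I. monom (of_nat (num_maps n g) :: real) (n + 1 - 2 * g))"
  proof (rule Sum_any.expand_superset)
    have "num_maps n g = 0" if "g \<notin> genus ` I" for g
    proof -
      have "{\<alpha> \<in> I. genus \<alpha> = g} = {}" using that by blast
      then show ?thesis unfolding count by (simp only: card.empty)
    qed
    then show "{g. monom (of_nat (num_maps n g) :: real) (n + 1 - 2 * g) \<noteq> 0} \<subseteq> genus ` I"
      by force
  qed (use finI in simp)
  also have "\<dots> = (\<Sum>g\<in>genus ` I. \<Sum>\<alpha>\<in>{\<alpha> \<in> I. genus \<alpha> = g}. monom 1 (v \<alpha>))"
  proof (intro sum.cong refl)
    fix g
    have "(\<Sum>\<alpha>\<in>{\<alpha> \<in> I. genus \<alpha> = g}. monom 1 (v \<alpha>)) =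
        (\<Sum>\<alpha>\<in>{\<alpha> \<in> I. genus \<alpha> = g}. monom (1 :: real) (n + 1 - 2 * g))"
    proof (intro sum.cong refl)
      fix \<alpha> assume "\<alpha> \<in> {\<alpha> \<in> I. genus \<alpha> = g}"
      then have "v \<alpha> = n + 1 - 2 * g" using genus[of \<alpha>] by auto
      then show "monom (1 :: real) (v \<alpha>) = monom 1 (n + 1 - 2 * g)" by simp
    qed
    also have "\<dots> = monom (of_nat (num_maps n g)) (n + 1 - 2 * g)"
      by (simp add: count of_nat_mult_conv_smult smult_monom)
    finally show "monom (of_nat (num_maps n g) :: real) (n + 1 - 2 * g) =
        (\<Sum>\<alpha>\<in>{\<alpha> \<in> I. genus \<alpha> = g}. monom 1 (v \<alpha>))" ..
  qed
  also have "\<dots> = P"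
    unfolding P_def using finI by (rule sum.image_gen[symmetric])
  finally show ?thesis using PR by simp
qed

end
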